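(* Let $\mathcal M$ be a structure satisfying one of the following: (a) $\mathcal M$ is a d-minimal expansion of an ordered group; (b) $\mathcal M$ is a weakly o-minimal expansion of an ordered field. Then $\mathfrak n_{\dim}(\mathcal M)\le 1$, i.e. there is at most one dimension function on $\mathcal M$.
   Context: "Definable" means definable in the structure with parameters; $\mathbb N$ is the set of nonnegative integers. Let $\mathcal M=(M,\ldots)$ be a structure, $\mathrm{Def}_n(\mathcal M)$ the collection of definable subsets of $M^n$, and $\mathrm{Def}(\mathcal M)=\bigcup_{n>0}\mathrm{Def}_n(\mathcal M)$. Let $\Pi:M^n\to M^{n-1}$ be the projection forgetting the last coordinate, and for $X\subseteq M^n$, $x\in\Pi(X)$, put $X_x^{\Pi}=\{y\in M: (x,y)\in X\}$. Convention: $-\infty+i=-\infty$. A *dimension function* on $\mathcal M$ is a function $\dim:\mathrm{Def}(\mathcal M)\to\mathbb N\cup\{-\infty\}$ such that for every $n>0$: (1) $\dim(\emptyset)=-\infty$, $\dim(\{a\})=0$ for each $a\in M$, and $\dim(M)=1$; $(2)_n$ $\dim(X\cup Y)=\max\{\dim X,\dim Y\}$ for $X,Y\in\mathrm{Def}_n(\mathcal M)$; $(3)_n$ $\dim X=\dim X^{\sigma}$ for each $X\in\mathrm{Def}_n(\mathcal M)$ and each permutation $\sigma$ of $\{1,\dots,n\}$, where $X^\sigma=\{(x_{\sigma(1)},\dots,x_{\sigma(n)}):(x_1,\dots,x_n)\in X\}$; $(4)_n$ if $n>1$ and $X\in\mathrm{Def}_n(\mathcal M)$, then for $i=0,1$ the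 set $X(i)=\{x\in\Pi(X):\dim X_x^{\Pi}=i\}$ belongs to $\mathrm{Def}_{n-1}(\mathcal M)$ and $\dim(X\cap\Pi^{-1}(X(i)))=\dim(X(i))+i$. $\mathfrak n_{\dim}(\mathcal M)$ is the cardinality of the set of dimension functions on $\mathcal M$. DLO means dense linear order without endpoints; for an expansion $\mathcal M=(M,<,\ldots)$ of DLO, $M$ carries the order topology. $\mathcal M$ is *definably complete* if every definable subset of $M$ has a supremum and an infimum in $M\cup\{\pm\infty\}$. $\mathcal M$ is *d-minimal* if it is a definably complete expansion of DLO and, for every $\mathcal N=(N,<,\ldots)$ elementarily equivalent to $\mathcal M$, every definable subset of $N$ is a union of an open set and finitely many discrete sets. $\mathcal M$ is *weakly o-minimal* if it is an expansion of DLO and every definable subset of $M$ is a union of finitely many convex sets. *)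

theory Defs
  imports
    "HOL-Library.Option_ord"
    "HOL-Library.Extended"
    "HOL-Library.FuncSet"
    "HOL-Combinatorics.Permutations"
    "HOL-Algebra.Ring"
    "HOL-Analysis.Abstract_Topology"
begin

unbundle cardinal_syntax

subsection \<open>First-order languages and structures\<close>

text \<open>The symbols of a language are the elements of the types \<open>'f\<close> and \<open>'r\<close>; constants are
  function symbols of arity 0. Interpretations take lists of arguments, and are only meaningful on
  lists whose length is the arity and whose entries lie in the universe.\<close>

record ('f, 'r) language =
  fun_arity :: "'f \<Rightarrow> nat"
  rel_arity :: "'r \<Rightarrow> nat"

record ('f, 'r, 'a) fo_structure =
  universe :: "'a set"
  fun_of :: "'f \<Rightarrow> 'a list \<Rightarrow> 'a"
  rel_of :: "'r \<Rightarrow> 'a list \<Rightarrow> bool"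

definition tuples :: "'a set \<Rightarrow> nat \<Rightarrow> 'a list set" where
  "tuples A n = {xs. length xs = n \<and> set xs \<subseteq> A}"

definition is_structure :: "('f, 'r) language \<Rightarrow> ('f, 'r, 'a) fo_structure \<Rightarrow> bool" where
  "is_structure L M \<longleftrightarrow> universe M \<noteq> {} \<and>
     (\<forall>f. \<forall>xs \<in> tuples (universe M) (fun_arity L f). fun_of M f xs \<in> universe M)"

datatype 'f trm = Var nat | Fn 'f "'f trm list"

datatype ('f, 'r) fm =
    FEq "'f trm" "'f trm"
  | FRel 'r "'f trm list"
  | FNeg "('f, 'r) fm"
  | FConj "('f, 'r) fm" "('f, 'r) fm"
  | FEx nat "('f, 'r) fm"

fun trm_vars :: "'f trm \<Rightarrow> nat set" where
  "trm_vars (Var i) = {i}"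
| "trm_vars (Fn f ts) = (\<Union>t \<in> set ts. trm_vars t)"

fun wf_trm :: "('f, 'r) language \<Rightarrow> 'f trm \<Rightarrow> bool" where
  "wf_trm L (Var i) \<longleftrightarrow> True"
| "wf_trm L (Fn f ts) \<longleftrightarrow> length ts = fun_arity L f \<and> (\<forall>t \<in> set ts. wf_trm L t)"

primrec eval_trm :: "('f, 'r, 'a) fo_structure \<Rightarrow> (nat \<Rightarrow> 'a) \<Rightarrow> 'f trm \<Rightarrow> 'a" where
  "eval_trm M e (Var i) = e i"
| "eval_trm M e (Fn f ts) = fun_of M f (map (eval_trm M e) ts)"

primrec free_vars :: "('f, 'r) fm \<Rightarrow> nat set" where
  "free_vars (FEq s t) = trm_vars s \<union> trm_vars t"
| "free_vars (FRel r ts) = (\<Union>t \<in> set ts. trm_vars t)"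
| "free_vars (FNeg \<phi>) = free_vars \<phi>"
| "free_vars (FConj \<phi> \<psi>) = free_vars \<phi> \<union> free_vars \<psi>"
| "free_vars (FEx i \<phi>) = free_vars \<phi> - {i}"

primrec wf_fm :: "('f, 'r) language \<Rightarrow> ('f, 'r) fm \<Rightarrow> bool" where
  "wf_fm L (FEq s t) \<longleftrightarrow> wf_trm L s \<and> wf_trm L t"
| "wf_fm L (FRel r ts) \<longleftrightarrow> length ts = rel_arity L r \<and> (\<forall>t \<in> set ts. wf_trm L t)"
| "wf_fm L (FNeg \<phi>) \<longleftrightarrow> wf_fm L \<phi>"
| "wf_fm L (FConj \<phi> \<psi>) \<longleftrightarrow> wf_fm L \<phi> \<and> wf_fm L \<psi>"
| "wf_fm L (FEx i \<phi>) \<longleftrightarrow> wf_fm L \<phi>"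

primrec sat :: "('f, 'r, 'a) fo_structure \<Rightarrow> (nat \<Rightarrow> 'a) \<Rightarrow> ('f, 'r) fm \<Rightarrow> bool" where
  "sat M e (FEq s t) \<longleftrightarrow> eval_trm M e s = eval_trm M e t"
| "sat M e (FRel r ts) \<longleftrightarrow> rel_of M r (map (eval_trm M e) ts)"
| "sat M e (FNeg \<phi>) \<longleftrightarrow> \<not> sat M e \<phi>"
| "sat M e (FConj \<phi> \<psi>) \<longleftrightarrow> sat M e \<phi> \<and> sat M e \<psi>"
| "sat M e (FEx i \<phi>) \<longleftrightarrow> (\<exists>a \<in> universe M. sat M (e(i := a)) \<phi>)"

definition models :: "('f, 'r, 'a) fo_structure \<Rightarrow> ('f, 'r) fm \<Rightarrow> bool" where
  "models M \<phi> \<longleftrightarrow> (\<forall>e. range e \<subseteq> universe M \<longrightarrow> sat M e \<phi>)"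

definition elementarily_equivalent ::
    "('f, 'r) language \<Rightarrow> ('f, 'r, 'a) fo_structure \<Rightarrow> ('f, 'r, 'b) fo_structure \<Rightarrow> bool" where
  "elementarily_equivalent L M N \<longleftrightarrow>
     (\<forall>\<phi>. wf_fm L \<phi> \<and> free_vars \<phi> = {} \<longrightarrow> (models M \<phi> \<longleftrightarrow> models N \<phi>))"

text \<open>The valuation \<open>e\<close> supplies the parameters: variables \<open>0, \<dots>, n - 1\<close> are the coordinates of the
  point, all others are interpreted by \<open>e\<close>.\<close>

definition Def_n ::
    "('f, 'r) language \<Rightarrow> ('f, 'r, 'a) fo_structure \<Rightarrow> nat \<Rightarrow> 'a list set set" where
  "Def_n L M n =
     {X. \<exists>\<phi> e. wf_fm L \<phi> \<and> range e \<subseteq> universe M \<and>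
        X = {xs \<in> tuples (universe M) n.
               sat M (\<lambda>i. if i < n then xs ! i else e i) \<phi>}}"

definition Def :: "('f, 'r) language \<Rightarrow> ('f, 'r, 'a) fo_structure \<Rightarrow> 'a list set set" where
  "Def L M = (\<Union>n \<in> {0<..}. Def_n L M n)"

text \<open>\<open>M\<close> is identified with \<open>M\<^sup>1\<close> along \<open>a \<mapsto> [a]\<close>.\<close>

definition definable_subset ::
    "('f, 'r) language \<Rightarrow> ('f, 'r, 'a) fo_structure \<Rightarrow> 'a set \<Rightarrow> bool" where
  "definable_subset L M A \<longleftrightarrow> (\<lambda>a. [a]) ` A \<in> Def_n L M 1"

subsection \<open>Dimension functions\<close>

definition fibre :: "'a list set \<Rightarrow> 'a list \<Rightarrow> 'a list set" where
  "fibre X x = {[y] | y. x @ [y] \<in> X}"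

definition fibre_dim_set ::
    "('a list set \<Rightarrow> nat option) \<Rightarrow> 'a list set \<Rightarrow> nat \<Rightarrow> 'a list set" where
  "fibre_dim_set \<delta> X i = {x \<in> butlast ` X. \<delta> (fibre X x) = Some i}"

text \<open>Values in \<open>\<nat> \<union> {-\<infinity>}\<close> are of type \<^typ>\<open>nat option\<close>, with \<^term>\<open>None\<close> for \<open>-\<infinity>\<close>; it is the
  least element of the order used here. Since the domain is \<^term>\<open>Def L M\<close>, functions are taken to
  be extensional there, so that equality of dimension functions is equality on definable sets.\<close>

definition dimension_function ::
    "('f, 'r) language \<Rightarrow> ('f, 'r, 'a) fo_structure \<Rightarrow> ('a list set \<Rightarrow> nat option) \<Rightarrow> bool" where
  "dimension_function L M \<delta> \<longleftrightarrow>
     \<delta> \<in> extensional (Def L M) \<and>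
     \<delta> {} = None \<and>
     (\<forall>a \<in> universe M. \<delta> {[a]} = Some 0) \<and>
     \<delta> (tuples (universe M) 1) = Some 1 \<and>
     (\<forall>n > 0. \<forall>X \<in> Def_n L M n. \<forall>Y \<in> Def_n L M n. \<delta> (X \<union> Y) = max (\<delta> X) (\<delta> Y)) \<and>
     (\<forall>n > 0. \<forall>X \<in> Def_n L M n. \<forall>\<sigma>. \<sigma> permutes {..<n} \<longrightarrow> \<delta> (permute_list \<sigma> ` X) = \<delta> X) \<and>
     (\<forall>n > 1. \<forall>X \<in> Def_n L M n. \<forall>i \<in> {0, 1}.
        fibre_dim_set \<delta> X i \<in> Def_n L M (n - 1) \<and>
        \<delta> (X \<inter> butlast -` fibre_dim_set \<delta> X i) =
          map_option (\<lambda>d. d + i) (\<delta> (fibre_dim_set \<delta> X i)))"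

definition n_dim ::
    "('f, 'r) language \<Rightarrow> ('f, 'r, 'a) fo_structure \<Rightarrow> ('a list set \<Rightarrow> nat option) rel" where
  "n_dim L M = |{\<delta>. dimension_function L M \<delta>}|"

subsection \<open>Expansions of dense linear orders\<close>

text \<open>The symbols \<open>lt\<close>, \<open>addf\<close>, \<open>mulf\<close> of the language name the order and the operations. Neutral
  elements and inverses need not be named.\<close>

abbreviation less_in :: "('f, 'r, 'a) fo_structure \<Rightarrow> 'r \<Rightarrow> 'a \<Rightarrow> 'a \<Rightarrow> bool" where
  "less_in M lt a b \<equiv> rel_of M lt [a, b]"

abbreviation op_in :: "('f, 'r, 'a) fo_structure \<Rightarrow> 'f \<Rightarrow> 'a \<Rightarrow> 'a \<Rightarrow> 'a" where
  "op_in M f a b \<equiv> fun_of M f [a, b]"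

definition DLO :: "'a set \<Rightarrow> ('a \<Rightarrow> 'a \<Rightarrow> bool) \<Rightarrow> bool" where
  "DLO A R \<longleftrightarrow> irreflp_on A R \<and> transp_on A R \<and> totalp_on A R \<and>
     (\<forall>a \<in> A. \<forall>b \<in> A. R a b \<longrightarrow> (\<exists>c \<in> A. R a c \<and> R c b)) \<and>
     (\<forall>a \<in> A. (\<exists>b \<in> A. R b a) \<and> (\<exists>b \<in> A. R a b))"

definition expansion_of_DLO ::
    "('f, 'r) language \<Rightarrow> 'r \<Rightarrow> ('f, 'r, 'a) fo_structure \<Rightarrow> bool" where
  "expansion_of_DLO L lt M \<longleftrightarrow>
     is_structure L M \<and> rel_arity L lt = 2 \<and> DLO (universe M) (less_in M lt)"

text \<open>No commutativity is required.\<close>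

definition expansion_of_ordered_group ::
    "('f, 'r) language \<Rightarrow> 'r \<Rightarrow> 'f \<Rightarrow> ('f, 'r, 'a) fo_structure \<Rightarrow> bool" where
  "expansion_of_ordered_group L lt addf M \<longleftrightarrow>
     is_structure L M \<and> rel_arity L lt = 2 \<and> fun_arity L addf = 2 \<and>
     irreflp_on (universe M) (less_in M lt) \<and>
     transp_on (universe M) (less_in M lt) \<and>
     totalp_on (universe M) (less_in M lt) \<and>
     (\<exists>z. group \<lparr>carrier = universe M, monoid.mult = op_in M addf, one = z\<rparr>) \<and>
     (\<forall>a \<in> universe M. \<forall>b \<in> universe M. \<forall>c \<in> universe M. less_in M lt a b \<longrightarrow>
        less_in M lt (op_in M addf a c) (op_in M addf b c) \<and>
        less_in M lt (op_in M addf c a) (op_in M addf c b))"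

definition expansion_of_ordered_field ::
    "('f, 'r) language \<Rightarrow> 'r \<Rightarrow> 'f \<Rightarrow> 'f \<Rightarrow> ('f, 'r, 'a) fo_structure \<Rightarrow> bool" where
  "expansion_of_ordered_field L lt addf mulf M \<longleftrightarrow>
     is_structure L M \<and> rel_arity L lt = 2 \<and> fun_arity L addf = 2 \<and> fun_arity L mulf = 2 \<and>
     irreflp_on (universe M) (less_in M lt) \<and>
     transp_on (universe M) (less_in M lt) \<and>
     totalp_on (universe M) (less_in M lt) \<and>
     (\<exists>z u. field \<lparr>carrier = universe M, monoid.mult = op_in M mulf, one = u,
                    zero = z, ring.add = op_in M addf\<rparr> \<and>
        (\<forall>a \<in> universe M. \<forall>b \<in> universe M. \<forall>c \<in> universe M. less_in M lt a b \<longrightarrow>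
           less_in M lt (op_in M addf a c) (op_in M addf b c)) \<and>
        (\<forall>a \<in> universe M. \<forall>b \<in> universe M. less_in M lt z a \<and> less_in M lt z b \<longrightarrow>
           less_in M lt z (op_in M mulf a b)))"

text \<open>The order on \<open>M \<union> {\<plusminus>\<infinity>}\<close> extending the strict order \<open>R\<close> of \<open>M\<close>.\<close>

fun ext_le :: "('a \<Rightarrow> 'a \<Rightarrow> bool) \<Rightarrow> 'a extended \<Rightarrow> 'a extended \<Rightarrow> bool" where
  "ext_le R (Fin a) (Fin b) \<longleftrightarrow> R a b \<or> a = b"
| "ext_le R Minf _ \<longleftrightarrow> True"
| "ext_le R _ Pinf \<longleftrightarrow> True"
| "ext_le R _ _ \<longleftrightarrow> False"

definition is_sup :: "'a set \<Rightarrow> ('a \<Rightarrow> 'a \<Rightarrow> bool) \<Rightarrow> 'a set \<Rightarrow> 'a extended \<Rightarrow> bool" where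
  "is_sup A R X s \<longleftrightarrow> s \<in> Fin ` A \<union> {Minf, Pinf} \<and> (\<forall>x \<in> X. ext_le R (Fin x) s) \<and>
     (\<forall>t \<in> Fin ` A \<union> {Minf, Pinf}. (\<forall>x \<in> X. ext_le R (Fin x) t) \<longrightarrow> ext_le R s t)"

definition is_inf :: "'a set \<Rightarrow> ('a \<Rightarrow> 'a \<Rightarrow> bool) \<Rightarrow> 'a set \<Rightarrow> 'a extended \<Rightarrow> bool" where
  "is_inf A R X s \<longleftrightarrow> s \<in> Fin ` A \<union> {Minf, Pinf} \<and> (\<forall>x \<in> X. ext_le R s (Fin x)) \<and>
     (\<forall>t \<in> Fin ` A \<union> {Minf, Pinf}. (\<forall>x \<in> X. ext_le R t (Fin x)) \<longrightarrow> ext_le R t s)"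

definition definably_complete ::
    "('f, 'r) language \<Rightarrow> 'r \<Rightarrow> ('f, 'r, 'a) fo_structure \<Rightarrow> bool" where
  "definably_complete L lt M \<longleftrightarrow>
     (\<forall>X. definable_subset L M X \<longrightarrow>
        (\<exists>s. is_sup (universe M) (less_in M lt) X s) \<and>
        (\<exists>s. is_inf (universe M) (less_in M lt) X s))"

text \<open>Open rays form a subbase of the order topology.\<close>

definition order_topology_in :: "'r \<Rightarrow> ('f, 'r, 'a) fo_structure \<Rightarrow> 'a topology" where
  "order_topology_in lt M = topology_generated_by
     ((\<lambda>a. {x \<in> universe M. less_in M lt a x}) ` universe M \<union>
      (\<lambda>a. {x \<in> universe M. less_in M lt x a}) ` universe M)"

definition open_union_finitely_many_discrete ::
    "'r \<Rightarrow> ('f, 'r, 'a) fo_structure \<Rightarrow> 'a set \<Rightarrow> bool" where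
  "open_union_finitely_many_discrete lt M X \<longleftrightarrow>
     (\<exists>U \<D>. X = U \<union> \<Union>\<D> \<and> openin (order_topology_in lt M) U \<and> finite \<D> \<and>
        (\<forall>D \<in> \<D>. D \<subseteq> universe M \<and> subtopology (order_topology_in lt M) D = discrete_topology D))"

text \<open>A HOL formula cannot quantify over all types, so \<open>\<N>\<close> ranges over the structures whose universe
  is a nonempty subset of the type \<^typ>\<open>nat \<Rightarrow> 'a\<close>. This loses nothing: the type has room for
  copies of \<open>\<M>\<close> and of its ultrapowers over \<open>\<nat>\<close>. Write \<open>\<phi>(\<N>,b)\<close> for the subset of \<open>N\<close> defined by
  \<open>\<phi>\<close> with parameters \<open>b\<close>. In a model of DLO, being the union of an open set and \<open>k\<close> discrete sets
  is, for fixed \<open>\<phi>\<close> and \<open>k\<close>, a first-order condition on \<open>b\<close> (after removing the interior, deleting the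
  isolated points \<open>k\<close> times leaves nothing). If some \<open>\<phi>(\<N>,b)\<close> fails it for every \<open>k\<close>, where \<open>\<N>\<close>
  is elementarily equivalent to \<open>\<M>\<close> and of arbitrary cardinality, then for each \<open>k\<close> some
  \<open>\<phi>(\<M>,b\<^sub>k)\<close> fails it, and so the set defined by \<open>\<phi>\<close> and the class of \<open>(b\<^sub>k)\<close> in a nonprincipal
  ultrapower of \<open>\<M>\<close> over \<open>\<nat>\<close> fails it for every \<open>k\<close>.\<close>

definition d_minimal ::
    "('f, 'r) language \<Rightarrow> 'r \<Rightarrow> ('f, 'r, 'a) fo_structure \<Rightarrow> bool" where
  "d_minimal L lt M \<longleftrightarrow> expansion_of_DLO L lt M \<and> definably_complete L lt M \<and>
     (\<forall>N :: ('f, 'r, nat \<Rightarrow> 'a) fo_structure.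
        is_structure L N \<and> elementarily_equivalent L M N \<longrightarrow>
        (\<forall>X. definable_subset L N X \<longrightarrow> open_union_finitely_many_discrete lt N X))"

definition convex_in :: "'r \<Rightarrow> ('f, 'r, 'a) fo_structure \<Rightarrow> 'a set \<Rightarrow> bool" where
  "convex_in lt M C \<longleftrightarrow> C \<subseteq> universe M \<and>
     (\<forall>a \<in> C. \<forall>b \<in> C. \<forall>x \<in> universe M. less_in M lt a x \<and> less_in M lt x b \<longrightarrow> x \<in> C)"

definition weakly_o_minimal ::
    "('f, 'r) language \<Rightarrow> 'r \<Rightarrow> ('f, 'r, 'a) fo_structure \<Rightarrow> bool" where
  "weakly_o_minimal L lt M \<longleftrightarrow> expansion_of_DLO L lt M \<and>
     (\<forall>X. definable_subset L M X \<longrightarrow>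
        (\<exists>\<C>. finite \<C> \<and> (\<forall>C \<in> \<C>. convex_in lt M C) \<and> X = \<Union>\<C>))"

end

theory Submission imports Defs begin

text \<open>A dimension function is determined by its values on definable \<open>X \<subseteq> M\<close>, since the axiom on
  fibres reduces \<open>M\<^bsup>n + 1\<^esup>\<close> to \<open>M\<^sup>n\<close>. On \<open>M\<close> the value is forced to be 1 if \<open>X\<close> contains an interval and
  0 if it is nonempty without one, because the dimension of a definable \<open>R \<subseteq> M\<^sup>2\<close> can be computed
  along either projection.

  Intervals: the \<open>a > 0\<close> with \<open>dim (0, a) = 0\<close> form the positive part of a convex subgroup; by definable
  completeness, resp. by homotheties of the field, there are none or they exhaust the positive elements.
  In the latter case \<open>{(x, y). 0 < y < x}\<close> has dimension \<open>1 + 0\<close> over \<open>x\<close> and \<open>1 + 1\<close> over \<open>y\<close>.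

  Sets without intervals: they are finite in the weakly o-minimal case. In the d-minimal case finitely
  many derivatives exhaust them, and each layer is a set \<open>D\<close> isolated on the right. The pairs \<open>(x, z)\<close>
  with \<open>x\<close> the last point of \<open>D\<close> up to \<open>z\<close> have dimension \<open>dim D + 1\<close>, and at most 1 because \<open>z\<close>
  determines \<open>x\<close>.\<close>

section \<open>Definable predicates\<close>

primrec rename_trm :: "(nat \<Rightarrow> nat) \<Rightarrow> 'f trm \<Rightarrow> 'f trm" where
  "rename_trm \<rho> (Var i) = Var (\<rho> i)"
| "rename_trm \<rho> (Fn f ts) = Fn f (map (rename_trm \<rho>) ts)"

primrec rename_fm :: "(nat \<Rightarrow> nat) \<Rightarrow> ('f, 'r) fm \<Rightarrow> ('f, 'r) fm" where
  "rename_fm \<rho> (FEq s t) = FEq (rename_trm \<rho> s) (rename_trm \<rho> t)"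
| "rename_fm \<rho> (FRel r ts) = FRel r (map (rename_trm \<rho>) ts)"
| "rename_fm \<rho> (FNeg \<phi>) = FNeg (rename_fm \<rho> \<phi>)"
| "rename_fm \<rho> (FConj \<phi> \<psi>) = FConj (rename_fm \<rho> \<phi>) (rename_fm \<rho> \<psi>)"
| "rename_fm \<rho> (FEx i \<phi>) = FEx (\<rho> i) (rename_fm \<rho> \<phi>)"

lemma wf_rename_trm: "wf_trm L (rename_trm \<rho> t) = wf_trm L t"
  by (induction t) auto

lemma wf_rename_fm: "wf_fm L (rename_fm \<rho> \<phi>) = wf_fm L \<phi>"
  by (induction \<phi>) (auto simp: wf_rename_trm)

lemma eval_rename_trm: "eval_trm M e (rename_trm \<rho> t) = eval_trm M (e \<circ> \<rho>) t"
  by (induction t) (auto simp: comp_def cong: map_cong)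

text \<open>Bound variables are renamed along with the free ones. For injective
  \<open>\<rho>\<close> nothing is captured: the update at \<open>\<rho> i\<close> becomes the
  update at \<open>i\<close> after composition.\<close>

lemma sat_rename_fm:
  assumes "inj \<rho>"
  shows "sat M e (rename_fm \<rho> \<phi>) = sat M (e \<circ> \<rho>) \<phi>"
proof (induction \<phi> arbitrary: e)
  case (FEx i \<phi>)
  have "(e(\<rho> i := a)) \<circ> \<rho> = (e \<circ> \<rho>)(i := a)" for a
    using assms by (auto simp: fun_eq_iff inj_eq)
  then show ?case by (simp only: rename_fm.simps sat.simps FEx)
qed (auto simp: eval_rename_trm comp_def)

section \<open>Predicates definable with parameters and their closure properties\<close>

definition interleave :: "(nat \<Rightarrow> 'a) \<Rightarrow> (nat \<Rightarrow> 'a) \<Rightarrow> nat \<Rightarrow> 'a" where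
  "interleave v e i = (if even i then v (i div 2) else e (i div 2))"

lemma interleave_simps [simp]:
  "interleave v e (2 * i) = v i" "interleave v e (Suc (2 * i)) = e i"
  by (simp_all add: interleave_def)

text \<open>Even variables are coordinates and odd ones parameters, so that two formulas with different
  parameters can be combined after an injective renaming of variables.\<close>

definition definable_pred ::
    "('f, 'r) language \<Rightarrow> ('f, 'r, 'a) fo_structure \<Rightarrow> ((nat \<Rightarrow> 'a) \<Rightarrow> bool) \<Rightarrow> bool" where
  "definable_pred L M P \<longleftrightarrow> (\<exists>\<phi> e. wf_fm L \<phi> \<and> range e \<subseteq> universe M \<and>
     (\<forall>v. range v \<subseteq> universe M \<longrightarrow> P v = sat M (interleave v e) \<phi>))"

text \<open>Reduces a change of variables to an injective \<open>\<rho>\<close> that reads the old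
  valuation off the new one.\<close>

lemma definable_predI:
  assumes "wf_fm L \<phi>" "range e \<subseteq> universe M" "inj \<rho>"
    and "\<And>v. range v \<subseteq> universe M \<Longrightarrow> P v = sat M (interleave v e \<circ> \<rho>) \<phi>"
  shows "definable_pred L M P"
  unfolding definable_pred_def
  using assms by (intro exI[of _ "rename_fm \<rho> \<phi>"] exI[of _ e])
    (simp add: wf_rename_fm sat_rename_fm)

lemma definable_pred_neg:
  "definable_pred L M P \<Longrightarrow> definable_pred L M (\<lambda>v. \<not> P v)"
  unfolding definable_pred_def by (metis sat.simps(3) wf_fm.simps(3))

lemma definable_pred_conj:
  assumes "definable_pred L M P" "definable_pred L M Q"
  shows "definable_pred L M (\<lambda>v. P v \<and> Q v)"
proof -
  obtain \<phi> e where 1: "wf_fm L \<phi>" "range e \<subseteq> universe M"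
      "\<And>v. range v \<subseteq> universe M \<Longrightarrow> P v = sat M (interleave v e) \<phi>"
    using assms(1) unfolding definable_pred_def by blast
  obtain \<psi> g where 2: "wf_fm L \<psi>" "range g \<subseteq> universe M"
      "\<And>v. range v \<subseteq> universe M \<Longrightarrow> Q v = sat M (interleave v g) \<psi>"
    using assms(2) unfolding definable_pred_def by blast
  \<comment> \<open>Even variables stay, and parameter number \<open>j\<close> gets number
    \<open>2 * j + k\<close>. So the parameters of \<open>\<phi>\<close> (\<open>k = 0\<close>) and
    of \<open>\<psi>\<close> (\<open>k = 1\<close>) share the odd variables as
    \<open>interleave e g\<close>.\<close>
  define \<rho> where "\<rho> k i = (if even i then i else 2 * (2 * (i div 2) + k) + 1)" for k i :: nat
  have inj: "inj (\<rho> k)" for k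
    by (rule injI) (auto simp: \<rho>_def split: if_splits elim!: oddE)
  have r: "interleave v (interleave e g) \<circ> \<rho> 0 = interleave v e"
      "interleave v (interleave e g) \<circ> \<rho> 1 = interleave v g" for v
    by (auto simp: fun_eq_iff \<rho>_def interleave_def elim!: oddE)
  have "range (interleave e g) \<subseteq> universe M"
    using 1(2) 2(2) by (auto simp: interleave_def)
  then show ?thesis
    unfolding definable_pred_def using 1 2 r
    by (intro exI[of _ "FConj (rename_fm (\<rho> 0) \<phi>) (rename_fm (\<rho> 1) \<psi>)"] exI[of _ "interleave e g"])
      (simp add: wf_rename_fm sat_rename_fm[OF inj])
qed

lemma definable_pred_ex:
  assumes "definable_pred L M P"
  shows "definable_pred L M (\<lambda>v. \<exists>a \<in> universe M. P (v(k := a)))"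
proof -
  obtain \<phi> e where 1: "wf_fm L \<phi>" "range e \<subseteq> universe M"
      "\<And>v. range v \<subseteq> universe M \<Longrightarrow> P v = sat M (interleave v e) \<phi>"
    using assms(1) unfolding definable_pred_def by blast
  \<comment> \<open>Coordinate \<open>k\<close> is the formula variable \<open>2 * k\<close>, so
    that is the one to quantify.\<close>
  have "(interleave v e)(2 * k := a) = interleave (v(k := a)) e" for v a
    by (auto simp: fun_eq_iff interleave_def)
  moreover have "range (v(k := a)) \<subseteq> universe M" if "range v \<subseteq> universe M" "a \<in> universe M"
    for v a
    using that by auto
  ultimately show ?thesis
    unfolding definable_pred_def using 1 by (intro exI[of _ "FEx (2 * k) \<phi>"] exI[of _ e]) simp
qed

lemma definable_pred_all:
  assumes "definable_pred L M P"
  shows "definable_pred L M (\<lambda>v. \<forall>a \<in> universe M. P (v(k := a)))"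
  using definable_pred_neg[OF definable_pred_ex[OF definable_pred_neg[OF assms]]] by simp

lemma definable_pred_imp:
  assumes "definable_pred L M P" "definable_pred L M Q"
  shows "definable_pred L M (\<lambda>v. P v \<longrightarrow> Q v)"
  using definable_pred_neg[OF definable_pred_conj[OF assms(1) definable_pred_neg[OF assms(2)]]]
  by simp

lemma definable_pred_specialize:
  assumes "definable_pred L M P" "range c \<subseteq> universe M"
  shows "definable_pred L M (\<lambda>v. P (\<lambda>i. if i \<in> S then c i else v i))"
proof -
  obtain \<phi> e where 1: "wf_fm L \<phi>" "range e \<subseteq> universe M"
      "\<And>v. range v \<subseteq> universe M \<Longrightarrow> P v = sat M (interleave v e) \<phi>"
    using assms(1) unfolding definable_pred_def by blast
  \<comment> \<open>A coordinate in \<open>S\<close> becomes an even-numbered parameter, where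
    \<open>interleave c e\<close> holds \<open>c\<close>; the old parameters become the odd-numbered
    ones.\<close>
  define \<rho> :: "nat \<Rightarrow> nat" where "\<rho> i = (if even i then (if i div 2 \<in> S then 2 * i + 1 else i)
     else 2 * i + 1)" for i
  show ?thesis
  proof (rule definable_predI[OF 1(1), of "interleave c e" _ \<rho>])
    show "range (interleave c e) \<subseteq> universe M"
      using 1(2) assms(2) by (auto simp: interleave_def)
    show "inj \<rho>"
      by (rule injI) (auto simp: \<rho>_def split: if_splits; presburger)
    fix v :: "nat \<Rightarrow> _" assume v: "range v \<subseteq> universe M"
    have "interleave v (interleave c e) \<circ> \<rho> = interleave (\<lambda>i. if i \<in> S then c i else v i) e"
      by (auto simp: fun_eq_iff \<rho>_def interleave_def)
    moreover have "range (\<lambda>i. if i \<in> S then c i else v i) \<subseteq> universe M"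
      using v assms(2) by auto
    ultimately show "P (\<lambda>i. if i \<in> S then c i else v i) =
        sat M (interleave v (interleave c e) \<circ> \<rho>) \<phi>"
      using 1(3) by simp
  qed
qed

lemma definable_pred_param:
  assumes "definable_pred L M P" "c \<in> universe M"
  shows "definable_pred L M (\<lambda>v. P (v(k := c)))"
proof -
  have "(\<lambda>i. if i \<in> {k} then c else v i) = v(k := c)" for v by auto
  then show ?thesis
    using definable_pred_specialize[OF assms(1), of "\<lambda>_. c" "{k}"] assms(2) by simp
qed

text \<open>Together with \<open>Def_nI\<close> this passes between \<open>Def_n\<close> and
  definable predicates. Distinctness of \<open>js\<close> makes the renaming injective.\<close>

lemma definable_pred_mem:
  assumes "X \<in> Def_n L M n" "distinct js" "length js = n"
  shows "definable_pred L M (\<lambda>v. map v js \<in> X)"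
proof -
  obtain \<phi> e where 1: "wf_fm L \<phi>" "range e \<subseteq> universe M"
      "X = {xs \<in> tuples (universe M) n. sat M (\<lambda>i. if i < n then xs ! i else e i) \<phi>}"
    using assms(1) unfolding Def_n_def by blast
  define \<rho> :: "nat \<Rightarrow> nat" where "\<rho> i = (if i < n then 2 * js ! i else 2 * i + 1)" for i
  show ?thesis
  proof (rule definable_predI[OF 1(1,2), of \<rho>])
    show "inj \<rho>"
      using assms(2,3)
      by (intro injI) (auto simp: \<rho>_def nth_eq_iff_index_eq split: if_splits; presburger)
    fix v :: "nat \<Rightarrow> _" assume v: "range v \<subseteq> universe M"
    have "interleave v e \<circ> \<rho> = (\<lambda>i. if i < n then map v js ! i else e i)"
      using assms(3) by (auto simp: fun_eq_iff \<rho>_def interleave_def)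
    moreover have "map v js \<in> tuples (universe M) n"
      using v assms(3) by (auto simp: tuples_def)
    ultimately show "(map v js \<in> X) = sat M (interleave v e \<circ> \<rho>) \<phi>"
      using 1(3) by simp
  qed
qed

lemma Def_nI:
  assumes "definable_pred L M P" "c \<in> universe M"
  shows "{xs \<in> tuples (universe M) n. P (\<lambda>i. if i < n then xs ! i else c)} \<in> Def_n L M n"
proof -
  obtain \<phi> e where 1: "wf_fm L \<phi>" "range e \<subseteq> universe M"
      "\<And>v. range v \<subseteq> universe M \<Longrightarrow> P v = sat M (interleave v e) \<phi>"
    using assms(1) unfolding definable_pred_def by blast
  \<comment> \<open>The variables of the first \<open>n\<close> coordinates go to
    \<open>0, ..., n - 1\<close>, and all others are shifted by \<open>n\<close> out of the way;
    \<open>g\<close> undoes the shift and gives the coordinates from \<open>n\<close> on the value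
    \<open>c\<close>.\<close>
  define \<rho> :: "nat \<Rightarrow> nat" where "\<rho> i = (if even i \<and> i div 2 < n then i div 2 else i + n)" for i
  define g where "g i = (if even (i - n) then c else e ((i - n) div 2))" for i
  have inj: "inj \<rho>"
    by (rule injI) (auto simp: \<rho>_def split: if_splits; presburger)
  have g: "range g \<subseteq> universe M"
    using 1(2) assms(2) by (auto simp: g_def)
  have "P (\<lambda>i. if i < n then xs ! i else c) =
      sat M (\<lambda>i. if i < n then xs ! i else g i) (rename_fm \<rho> \<phi>)"
    if "xs \<in> tuples (universe M) n" for xs
  proof -
    have "(\<lambda>i. if i < n then xs ! i else g i) \<circ> \<rho> = interleave (\<lambda>i. if i < n then xs ! i else c) e"
      by (auto simp: fun_eq_iff \<rho>_def interleave_def g_def)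
    moreover have "range (\<lambda>i. if i < n then xs ! i else c) \<subseteq> universe M"
      using that assms(2) by (auto simp: tuples_def)
    ultimately show ?thesis by (simp add: sat_rename_fm[OF inj] 1(3))
  qed
  then show ?thesis
    unfolding Def_n_def using 1(1) g by (auto simp: wf_rename_fm intro!: exI[of _ "rename_fm \<rho> \<phi>"] exI[of _ g])
qed

lemma definable_pred_eq: "universe M \<noteq> {} \<Longrightarrow> definable_pred L M (\<lambda>v. v i = v j)"
  unfolding definable_pred_def
  by (intro exI[of _ "FEq (Var (2 * i)) (Var (2 * j))"]) auto

lemma definable_pred_rel2:
  "universe M \<noteq> {} \<Longrightarrow> rel_arity L r = 2 \<Longrightarrow> definable_pred L M (\<lambda>v. rel_of M r [v i, v j])"
  unfolding definable_pred_def
  by (intro exI[of _ "FRel r [Var (2 * i), Var (2 * j)]"]) auto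

lemma definable_pred_fun2:
  "universe M \<noteq> {} \<Longrightarrow> fun_arity L f = 2 \<Longrightarrow> definable_pred L M (\<lambda>v. fun_of M f [v i, v j] = v k)"
  unfolding definable_pred_def
  by (intro exI[of _ "FEq (Fn f [Var (2 * i), Var (2 * j)]) (Var (2 * k))"]) auto

lemma definable_pred_mem1:
  assumes "definable_subset L M A"
  shows "definable_pred L M (\<lambda>v. v i \<in> A)"
proof -
  have "definable_pred L M (\<lambda>v. map v [i] \<in> (\<lambda>a. [a]) ` A)"
    using assms by (intro definable_pred_mem[where n = 1]) (simp_all add: definable_subset_def)
  then show ?thesis by (simp add: image_iff)
qed

lemma definable_subsetI:
  assumes "definable_pred L M (\<lambda>v. P (v 0))"
  shows "definable_subset L M {x \<in> universe M. P x}"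
proof (cases "universe M = {}")
  case True
  \<comment> \<open>No valuation has its range in an empty universe, so the hypothesis is
    contradictory.\<close>
  then show ?thesis
    using assms by (auto simp: definable_subset_def Def_n_def definable_pred_def)
next
  case False
  then obtain c where "c \<in> universe M" by blast
  from Def_nI[OF assms this, of 1] show ?thesis
    unfolding definable_subset_def
    by (rule back_subst[of "\<lambda>X. X \<in> Def_n L M 1"])
      (auto simp: tuples_def length_Suc_conv image_iff)
qed

lemma definable_subset_sub:
  assumes "definable_subset L M A"
  shows "A \<subseteq> universe M"
proof -
  have "(\<lambda>a. [a]) ` A \<subseteq> tuples (universe M) 1"
    using assms by (auto simp only: definable_subset_def Def_n_def)
  then show ?thesis by (auto simp: tuples_def)
qed

lemma definable_pred_reindex:
  assumes "definable_pred L M P" "inj s"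
  shows "definable_pred L M (\<lambda>v. P (v \<circ> s))"
proof -
  obtain \<phi> e where 1: "wf_fm L \<phi>" "range e \<subseteq> universe M"
      "\<And>v. range v \<subseteq> universe M \<Longrightarrow> P v = sat M (interleave v e) \<phi>"
    using assms(1) unfolding definable_pred_def by blast
  define \<rho> :: "nat \<Rightarrow> nat" where "\<rho> i = (if even i then 2 * s (i div 2) else i)" for i
  show ?thesis
  proof (rule definable_predI[OF 1(1,2), of \<rho>])
    show "inj \<rho>"
    proof (rule injI)
      fix i j assume eq: "\<rho> i = \<rho> j"
      then have "even i = even j" by (auto simp: \<rho>_def split: if_splits)
      then show "i = j"
        using eq inj_eq[OF assms(2)] by (auto simp: \<rho>_def split: if_splits elim!: evenE)
    qed
    fix v :: "nat \<Rightarrow> _" assume v: "range v \<subseteq> universe M"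
    have "interleave v e \<circ> \<rho> = interleave (v \<circ> s) e"
      by (auto simp: fun_eq_iff \<rho>_def interleave_def)
    moreover have "range (v \<circ> s) \<subseteq> universe M" using v by auto
    ultimately show "P (v \<circ> s) = sat M (interleave v e \<circ> \<rho>) \<phi>" using 1(3) by simp
  qed
qed

lemma definable_pred_swap:
  assumes "definable_pred L M (\<lambda>v. R (v 0) (v 1))"
  shows "definable_pred L M (\<lambda>v. R (v 1) (v 0))"
  using definable_pred_reindex[OF assms, of "transpose 0 1"] by simp

lemma definable_section:
  assumes "definable_pred L M (\<lambda>v. R (v 0) (v 1))" "a \<in> universe M"
  shows "definable_subset L M {y \<in> universe M. R a y}"
  \<comment> \<open>After the swap the free coordinate is number 0, as
    \<open>definable_subsetI\<close> requires, and number 1 becomes the parameter.\<close>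
  using definable_pred_param[OF definable_pred_swap[OF assms(1)] assms(2), of 1]
  by (intro definable_subsetI) simp

lemma definable_domain:
  assumes "definable_pred L M (\<lambda>v. R (v 0) (v 1))"
  shows "definable_subset L M {x \<in> universe M. \<exists>y \<in> universe M. R x y}"
  using definable_pred_ex[OF assms, of 1] by (intro definable_subsetI) simp

lemma Def_2I:
  assumes "definable_pred L M (\<lambda>v. R (v 0) (v 1))" "universe M \<noteq> {}"
  shows "{[x, y] | x y. x \<in> universe M \<and> y \<in> universe M \<and> R x y} \<in> Def_n L M 2"
proof -
  obtain c where "c \<in> universe M" using assms(2) by blast
  from Def_nI[OF assms(1) this, of 2] show ?thesis
    by (rule back_subst[of "\<lambda>X. X \<in> Def_n L M 2"])
      (fastforce simp: tuples_def length_Suc_conv numeral_2_eq_2)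
qed

lemma definable_subset_Un:
  assumes "definable_subset L M A" "definable_subset L M B"
  shows "definable_subset L M (A \<union> B)"
proof -
  have "definable_pred L M (\<lambda>v. v 0 \<notin> A \<longrightarrow> v 0 \<in> B)"
    using assms by (intro definable_pred_imp definable_pred_neg definable_pred_mem1)
  moreover have "{x \<in> universe M. x \<notin> A \<longrightarrow> x \<in> B} = A \<union> B"
    using assms[THEN definable_subset_sub] by blast
  ultimately show ?thesis using definable_subsetI[of L M "\<lambda>x. x \<notin> A \<longrightarrow> x \<in> B"] by simp
qed

lemma Def_n_sub: "X \<in> Def_n L M n \<Longrightarrow> X \<subseteq> tuples (universe M) n"
  by (auto simp only: Def_n_def)

section \<open>Dimension functions\<close>

locale dim_fun =
  fixes L :: "('f, 'r) language" and M :: "('f, 'r, 'a) fo_structure"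
    and \<delta> :: "'a list set \<Rightarrow> nat option"
  assumes dimension_function: "dimension_function L M \<delta>"
    and universe_nonempty: "universe M \<noteq> {}"
begin

definition dim1 :: "'a set \<Rightarrow> nat option" where
  "dim1 A = \<delta> ((\<lambda>a. [a]) ` A)"

lemma dim_Un:
  "n > 0 \<Longrightarrow> X \<in> Def_n L M n \<Longrightarrow> Y \<in> Def_n L M n \<Longrightarrow> \<delta> (X \<union> Y) = max (\<delta> X) (\<delta> Y)"
  using dimension_function unfolding dimension_function_def by (elim conjE) blast

lemma dim_permute:
  "n > 0 \<Longrightarrow> X \<in> Def_n L M n \<Longrightarrow> \<sigma> permutes {..<n} \<Longrightarrow> \<delta> (permute_list \<sigma> ` X) = \<delta> X"
  using dimension_function unfolding dimension_function_def by (elim conjE) blast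

lemma dim_fibre_dim_set:
  assumes "n > 1" "X \<in> Def_n L M n" "i \<in> {0, 1}"
  shows "fibre_dim_set \<delta> X i \<in> Def_n L M (n - 1)"
    and "\<delta> (X \<inter> butlast -` fibre_dim_set \<delta> X i) =
           map_option (\<lambda>d. d + i) (\<delta> (fibre_dim_set \<delta> X i))"
  using dimension_function assms unfolding dimension_function_def by ((elim conjE)?, blast)+

lemma definable_universe: "definable_subset L M (universe M)"
  using definable_subsetI[of L M "\<lambda>_. True"] definable_pred_eq[OF universe_nonempty, of L 0 0]
  by simp

lemma dim1_empty: "dim1 {} = None"
  using dimension_function by (simp add: dim1_def dimension_function_def)

lemma dim1_singleton: "a \<in> universe M \<Longrightarrow> dim1 {a} = Some 0"
  using dimension_function by (simp add: dim1_def dimension_function_def)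

lemma dim1_universe: "dim1 (universe M) = Some 1"
proof -
  have "(\<lambda>a. [a]) ` universe M = tuples (universe M) 1"
    by (auto simp: tuples_def length_Suc_conv image_iff)
  then show ?thesis
    using dimension_function by (simp add: dim1_def dimension_function_def)
qed

lemma dim1_Un:
  assumes "definable_subset L M A" "definable_subset L M B"
  shows "dim1 (A \<union> B) = max (dim1 A) (dim1 B)"
  using assms dim_Un[of 1] by (simp add: dim1_def definable_subset_def image_Un)

lemma dim1_mono:
  assumes "definable_subset L M A" "definable_subset L M B" "A \<subseteq> B"
  shows "dim1 A \<le> dim1 B"
  using dim1_Un[OF assms(1,2)] max.cobounded1[of "dim1 A" "dim1 B"] assms(3)
  by (simp add: Un_absorb1)

lemma definable_singleton: "a \<in> universe M \<Longrightarrow> definable_subset L M {a}"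
  using definable_subsetI[of L M "\<lambda>x. x = a"]
    definable_pred_param[OF definable_pred_eq[OF universe_nonempty, of L 0 1], of a 1]
  by (simp add: Collect_conv_if)

text \<open>Monotonicity squeezes \<open>A\<close> between one of its points, of dimension 0, and
  the universe, of dimension 1.\<close>

lemma dim1_cases:
  assumes "definable_subset L M A" "A \<noteq> {}"
  obtains "dim1 A = Some 0" | "dim1 A = Some 1"
proof -
  obtain a where a: "a \<in> A" "a \<in> universe M"
    using assms definable_subset_sub by blast
  have "Some 0 \<le> dim1 A"
    using dim1_mono[OF definable_singleton[OF a(2)] assms(1)] a by (simp add: dim1_singleton)
  moreover have "dim1 A \<le> Some 1"
    using dim1_mono[OF assms(1) definable_universe] definable_subset_sub[OF assms(1)]
    by (simp add: dim1_universe)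
  ultimately show ?thesis
    using that by (cases "dim1 A") (auto simp: le_Suc_eq)
qed

lemma dim1_finite:
  assumes "finite A" "A \<subseteq> universe M" "A \<noteq> {}"
  shows "definable_subset L M A \<and> dim1 A = Some 0"
  using assms(1,3,2)
proof (induction rule: finite_ne_induct)
  case (singleton x)
  then show ?case by (simp add: dim1_singleton definable_singleton)
next
  case (insert x F)
  then have "definable_subset L M ({x} \<union> F)"
    by (simp add: definable_subset_Un definable_singleton del: Un_insert_left)
  then show ?case
    using insert dim1_Un[OF definable_singleton, of x F] by (simp add: dim1_singleton)
qed

section \<open>Binary relations and their two projections\<close>

lemma dim1_fibration:
  assumes R: "definable_pred L M (\<lambda>v. R (v 0) (v 1))"
    and i: "i \<in> {0, 1}"
    and fib: "\<And>x. x \<in> universe M \<Longrightarrow> \<exists>y \<in> universe M. R x y \<Longrightarrow>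
                 dim1 {y \<in> universe M. R x y} = Some i"
  shows "\<delta> {[x, y] | x y. x \<in> universe M \<and> y \<in> universe M \<and> R x y} =
           map_option (\<lambda>d. d + i) (dim1 {x \<in> universe M. \<exists>y \<in> universe M. R x y})"
proof -
  let ?X = "{[x, y] | x y. x \<in> universe M \<and> y \<in> universe M \<and> R x y}"
  have X: "?X \<in> Def_n L M 2" by (rule Def_2I[OF R universe_nonempty])
  have fibre: "fibre ?X [x] = (\<lambda>y. [y]) ` {y \<in> universe M. R x y}" if "x \<in> universe M" for x
    using that by (auto simp: fibre_def)
  have butlast: "butlast ` ?X = (\<lambda>x. [x]) ` {x \<in> universe M. \<exists>y \<in> universe M. R x y}"
    by (force simp: image_iff)
  \<comment> \<open>All nonempty fibres have dimension \<open>i\<close>, so the set in the axiom on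
    fibres is the whole projection, and the part of \<open>?X\<close> above it is
    \<open>?X\<close>.\<close>
  have "fibre_dim_set \<delta> ?X i = butlast ` ?X"
  proof -
    have "\<delta> (fibre ?X z) = Some i" if z: "z \<in> butlast ` ?X" for z
    proof -
      obtain x where x: "z = [x]" "x \<in> universe M" "\<exists>y \<in> universe M. R x y"
        using z unfolding butlast by blast
      show ?thesis using fib[OF x(2,3)] by (simp add: x(1) fibre[OF x(2)] dim1_def)
    qed
    then show ?thesis unfolding fibre_dim_set_def by blast
  qed
  moreover have "?X \<inter> butlast -` butlast ` ?X = ?X" by auto
  moreover have "\<delta> (?X \<inter> butlast -` fibre_dim_set \<delta> ?X i) =
      map_option (\<lambda>d. d + i) (\<delta> (fibre_dim_set \<delta> ?X i))"
    using dim_fibre_dim_set(2)[OF _ X i] by simp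
  ultimately show "\<delta> ?X = map_option (\<lambda>d. d + i) (dim1 {x \<in> universe M. \<exists>y \<in> universe M. R x y})"
    by (simp add: dim1_def butlast)
qed

text \<open>The definability half of the axiom on fibres. It yields definable sets whose description
  mentions \<open>\<delta>\<close>, to which definable completeness can then be applied.\<close>

lemma definable_fibre_dim:
  assumes R: "definable_pred L M (\<lambda>v. R (v 0) (v 1))" and i: "i \<in> {0, 1}"
  shows "definable_subset L M
    {x \<in> universe M. (\<exists>y \<in> universe M. R x y) \<and> dim1 {y \<in> universe M. R x y} = Some i}"
proof -
  define X where "X = {[x, y] | x y. x \<in> universe M \<and> y \<in> universe M \<and> R x y}"
  let ?A = "{x \<in> universe M. (\<exists>y \<in> universe M. R x y) \<and> dim1 {y \<in> universe M. R x y} = Some i}"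
  have "fibre X [x] = (\<lambda>y. [y]) ` {y \<in> universe M. R x y}" if "x \<in> universe M" for x
    using that by (auto simp: fibre_def X_def)
  then have fibre: "\<delta> (fibre X [x]) = dim1 {y \<in> universe M. R x y}" if "x \<in> universe M" for x
    using that by (simp add: dim1_def)
  have butlast: "butlast ` X = (\<lambda>x. [x]) ` {x \<in> universe M. \<exists>y \<in> universe M. R x y}"
    unfolding X_def by (force simp: image_iff)
  have "fibre_dim_set \<delta> X i = (\<lambda>x. [x]) ` ?A"
    unfolding fibre_dim_set_def butlast using fibre by auto
  moreover have "fibre_dim_set \<delta> X i \<in> Def_n L M 1"
    using dim_fibre_dim_set(1)[OF _ Def_2I[OF R universe_nonempty] i] by (simp add: X_def)
  ultimately show ?thesis by (simp add: definable_subset_def)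
qed

text \<open>Both sides are the dimension of the relation, computed over the first coordinate and,
  after exchanging the coordinates, over the second.\<close>

lemma dim1_double_fibration:
  assumes R: "definable_pred L M (\<lambda>v. R (v 0) (v 1))"
    and ij: "i \<in> {0, 1}" "j \<in> {0, 1}"
    and A: "A = {x \<in> universe M. \<exists>y \<in> universe M. R x y}"
    and B: "B = {y \<in> universe M. \<exists>x \<in> universe M. R x y}"
    and fibA: "\<And>x. x \<in> A \<Longrightarrow> dim1 {y \<in> universe M. R x y} = Some i"
    and fibB: "\<And>y. y \<in> B \<Longrightarrow> dim1 {x \<in> universe M. R x y} = Some j"
  shows "map_option (\<lambda>d. d + i) (dim1 A) = map_option (\<lambda>d. d + j) (dim1 B)"
proof -
  let ?X = "{[x, y] | x y. x \<in> universe M \<and> y \<in> universe M \<and> R x y}"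
  let ?Y = "{[y, x] | y x. y \<in> universe M \<and> x \<in> universe M \<and> R x y}"
  have X: "\<delta> ?X = map_option (\<lambda>d. d + i) (dim1 A)" "?X \<in> Def_n L M 2"
    using dim1_fibration[of R i, OF R ij(1)] fibA A Def_2I[OF R universe_nonempty] by auto
  have "\<delta> ?Y = map_option (\<lambda>d. d + j) (dim1 B)"
    using dim1_fibration[of "\<lambda>y x. R x y" j, OF definable_pred_swap[OF R] ij(2)] fibB B by simp
  moreover
  let ?\<sigma> = "transpose 0 (1::nat)"
  have perm: "?\<sigma> permutes {..<2}" by (rule permutes_swap_id) auto
  have "permute_list ?\<sigma> [x, y] = [y, x]" for x y :: 'a
    by (simp add: permute_list_def upt_rec numeral_2_eq_2)
  then have "permute_list ?\<sigma> ` ?X = ?Y"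
    by (force simp: image_iff)
  then have "\<delta> ?X = \<delta> ?Y"
    using dim_permute[OF _ X(2) perm] by simp
  ultimately show ?thesis using X by simp
qed

text \<open>The graph of a definable injection has one-point fibres over both projections.\<close>

lemma dim1_image:
  assumes G: "definable_pred L M (\<lambda>v. v 0 \<in> A \<and> v 1 = f (v 0))"
    and A: "A \<subseteq> universe M" and f: "f ` A \<subseteq> universe M" "inj_on f A"
  shows "dim1 (f ` A) = dim1 A"
proof -
  have "map_option (\<lambda>d. d + 0) (dim1 A) = map_option (\<lambda>d. d + 0) (dim1 (f ` A))"
  proof (rule dim1_double_fibration[of "\<lambda>x y. x \<in> A \<and> y = f x"])
    fix x assume x: "x \<in> A"
    then have "{y \<in> universe M. x \<in> A \<and> y = f x} = {f x}" using f by auto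
    then show "dim1 {y \<in> universe M. x \<in> A \<and> y = f x} = Some 0"
      using x f dim1_singleton by auto
  next
    fix y assume "y \<in> f ` A"
    then obtain x where x: "x \<in> A" "y = f x" by blast
    then have "{x \<in> universe M. x \<in> A \<and> y = f x} = {x}" using A f by (auto simp: inj_on_eq_iff)
    then show "dim1 {x \<in> universe M. x \<in> A \<and> y = f x} = Some 0"
      using x A dim1_singleton by auto
  qed (use G A f in auto)
  then show ?thesis by (simp add: option.map_ident)
qed

section \<open>Reduction of the number of coordinates\<close>

lemma definable_fibre:
  assumes "X \<in> Def_n L M (Suc n)" "x \<in> tuples (universe M) n"
  shows "definable_subset L M {y \<in> universe M. x @ [y] \<in> X}"
proof -
  obtain c where c: "c \<in> universe M" using universe_nonempty by blast
  \<comment> \<open>Entry \<open>i - 1\<close> of \<open>x\<close> is placed at coordinate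
    \<open>i\<close>, so that coordinate 0 stays free for the last entry.\<close>
  define e where "e i = (if i \<in> {1..n} then x ! (i - 1) else c)" for i
  have x: "length x = n" "set x \<subseteq> universe M" using assms(2) by (auto simp: tuples_def)
  have "e i \<in> universe M" for i
    using x c nth_mem[of "i - 1" x] by (auto simp: e_def)
  then have "range e \<subseteq> universe M" by blast
  moreover have "definable_pred L M (\<lambda>v. map v ([1..<Suc n] @ [0]) \<in> X)"
    using assms(1) by (rule definable_pred_mem) (simp_all del: upt_Suc)
  ultimately have "definable_pred L M
      (\<lambda>v. map (\<lambda>i. if i \<in> {1..n} then e i else v i) ([1..<Suc n] @ [0]) \<in> X)"
    by (rule definable_pred_specialize[rotated])
  moreover have "map (\<lambda>i. if i \<in> {1..n} then e i else v i) [1..<Suc n] = x" for v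
    using x(1) by (intro nth_equalityI) (simp_all add: e_def del: upt_Suc)
  ultimately show ?thesis
    by (intro definable_subsetI) (simp del: upt_Suc)
qed

lemma fibre_eq:
  assumes "X \<in> Def_n L M n"
  shows "fibre X x = (\<lambda>y. [y]) ` {y \<in> universe M. x @ [y] \<in> X}"
proof -
  have "X \<subseteq> tuples (universe M) n" by (rule Def_n_sub[OF assms])
  then show ?thesis by (force simp: fibre_def tuples_def)
qed

text \<open>Over each point of the projection the fibre is a nonempty definable subset of the
  universe, hence of dimension 0 or 1. The two corresponding parts therefore cover \<open>X\<close>,
  and the axiom on fibres gives their dimensions.\<close>

lemma dim_decompose:
  assumes n: "n > 0" and X: "X \<in> Def_n L M (Suc n)"
  shows "\<delta> X = max (\<delta> (fibre_dim_set \<delta> X 0))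
                   (map_option Suc (\<delta> (fibre_dim_set \<delta> X 1)))"
    and "i \<in> {0, 1} \<Longrightarrow> fibre_dim_set \<delta> X i \<in> Def_n L M n"
proof -
  define Y where "Y i = X \<inter> butlast -` fibre_dim_set \<delta> X i" for i
  have fib: "fibre_dim_set \<delta> X i \<in> Def_n L M n"
      "\<delta> (Y i) = map_option (\<lambda>d. d + i) (\<delta> (fibre_dim_set \<delta> X i))" if "i \<in> {0, 1}" for i
    using dim_fibre_dim_set[OF _ X that] n by (simp_all add: Y_def)
  then show "i \<in> {0, 1} \<Longrightarrow> fibre_dim_set \<delta> X i \<in> Def_n L M n" by blast
  have sub: "X \<subseteq> tuples (universe M) (Suc n)" by (rule Def_n_sub[OF X])
  have Y: "Y i \<in> Def_n L M (Suc n)" if "i \<in> {0, 1}" for i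
  proof -
    obtain c where c: "c \<in> universe M" using universe_nonempty by blast
    have "definable_pred L M (\<lambda>v. map v [0..<Suc n] \<in> X \<and> map v [0..<n] \<in> fibre_dim_set \<delta> X i)"
      by (intro definable_pred_conj definable_pred_mem[OF X] definable_pred_mem[OF fib(1)[OF that]])
        auto
    from Def_nI[OF this c, of "Suc n"] show ?thesis
    proof (rule back_subst[of "\<lambda>X. X \<in> Def_n L M (Suc n)"])
      have "map (\<lambda>i. if i < Suc n then xs ! i else c) [0..<Suc n] = xs"
        "map (\<lambda>i. if i < Suc n then xs ! i else c) [0..<n] = butlast xs" if "length xs = Suc n" for xs
        using that by (auto intro!: nth_equalityI simp: nth_butlast simp del: upt_Suc)
      then show "{xs \<in> tuples (universe M) (Suc n).
          map (\<lambda>i. if i < Suc n then xs ! i else c) [0..<Suc n] \<in> X \<and>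
          map (\<lambda>i. if i < Suc n then xs ! i else c) [0..<n] \<in> fibre_dim_set \<delta> X i} = Y i"
        using sub unfolding Y_def by (auto simp: tuples_def simp del: upt_Suc)
    qed
  qed
  have "X \<subseteq> Y 0 \<union> Y 1"
  proof
    fix xs assume xs: "xs \<in> X"
    then obtain x y where xy: "xs = x @ [y]" "x \<in> tuples (universe M) n" "y \<in> universe M"
      using sub by (cases xs rule: rev_cases) (auto simp: tuples_def)
    let ?F = "{y \<in> universe M. x @ [y] \<in> X}"
    have "\<delta> (fibre X x) = dim1 ?F" by (simp add: fibre_eq[OF X] dim1_def)
    moreover have "definable_subset L M ?F" "?F \<noteq> {}"
      using definable_fibre[OF X xy(2)] xs xy by auto
    ultimately have "\<delta> (fibre X x) = Some 0 \<or> \<delta> (fibre X x) = Some 1"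
      using dim1_cases by metis
    moreover have "x \<in> butlast ` X" using xs xy by force
    ultimately show "xs \<in> Y 0 \<union> Y 1" using xs xy by (auto simp: Y_def fibre_dim_set_def)
  qed
  then have "X = Y 0 \<union> Y 1" by (auto simp: Y_def)
  moreover have "\<delta> (Y 0 \<union> Y 1) = max (\<delta> (Y 0)) (\<delta> (Y 1))"
    using dim_Un[OF _ Y Y, of 0 1] by simp
  ultimately show "\<delta> X = max (\<delta> (fibre_dim_set \<delta> X 0))
                   (map_option Suc (\<delta> (fibre_dim_set \<delta> X 1)))"
    using fib(2)[of 0] fib(2)[of 1] by (simp add: option.map_ident)
qed

end

text \<open>Induction on the number of coordinates: by \<open>eq\<close> both functions select the
  same sets \<open>fibre_dim_set\<close>, to which the induction hypothesis applies in the formula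
  of \<open>dim_decompose\<close>. Off \<open>Def L M\<close> the functions agree by
  extensionality.\<close>

lemma dimension_function_eqI:
  assumes "dimension_function L M \<delta>" "dimension_function L M \<delta>'" "universe M \<noteq> {}"
    and eq: "\<And>A. definable_subset L M A \<Longrightarrow> \<delta> ((\<lambda>a. [a]) ` A) = \<delta>' ((\<lambda>a. [a]) ` A)"
  shows "\<delta> = \<delta>'"
proof -
  interpret d: dim_fun L M \<delta> using assms by unfold_locales
  interpret d': dim_fun L M \<delta>' using assms by unfold_locales
  have "\<forall>X \<in> Def_n L M (Suc n). \<delta> X = \<delta>' X" for n
  proof (induction n)
    case 0
    show ?case
    proof
      fix X assume X: "X \<in> Def_n L M (Suc 0)"
      then have "X \<subseteq> tuples (universe M) (Suc 0)" by (rule Def_n_sub)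
      then have "X = (\<lambda>a. [a]) ` {a. [a] \<in> X}"
        by (force simp: tuples_def length_Suc_conv)
      then show "\<delta> X = \<delta>' X"
        using eq[of "{a. [a] \<in> X}"] X by (simp add: definable_subset_def)
    qed
  next
    case (Suc n)
    show ?case
    proof
      fix X assume X: "X \<in> Def_n L M (Suc (Suc n))"
      have "\<delta> (fibre X x) = \<delta>' (fibre X x)" if "x \<in> butlast ` X" for x
      proof -
        have "X \<subseteq> tuples (universe M) (Suc (Suc n))" by (rule Def_n_sub[OF X])
        then have "x \<in> tuples (universe M) (Suc n)"
          using that by (auto simp: tuples_def dest: in_set_butlastD)
        then show ?thesis
          using eq[OF d.definable_fibre[OF X]] by (simp add: d.fibre_eq[OF X])
      qed
      then have "fibre_dim_set \<delta> X i = fibre_dim_set \<delta>' X i" for i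
        by (auto simp: fibre_dim_set_def)
      then show "\<delta> X = \<delta>' X"
        using d.dim_decompose[OF _ X] d'.dim_decompose(1)[OF _ X] Suc by simp
    qed
  qed
  then have "\<delta> X = \<delta>' X" if "X \<in> Def L M" for X
    using that by (auto simp: Def_def gr0_conv_Suc)
  moreover have "\<delta> \<in> extensional (Def L M)" "\<delta>' \<in> extensional (Def L M)"
    using assms by (auto simp: dimension_function_def)
  ultimately show ?thesis by (intro extensionalityI)
qed

section \<open>Dense linear orders\<close>

locale dlo =
  fixes M :: "('f, 'r, 'a) fo_structure" and lt :: 'r
  assumes DLO: "DLO (universe M) (less_in M lt)"
begin

abbreviation less (infix \<open>\<prec>\<close> 50) where "x \<prec> y \<equiv> less_in M lt x y"

text \<open>One-sided discreteness, expressed by the order alone so that it transfers along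
  isomorphisms without any topology.\<close>

definition right_isolated :: "'a set \<Rightarrow> bool" where
  "right_isolated D \<longleftrightarrow> (\<forall>x \<in> D. \<exists>b \<in> universe M. x \<prec> b \<and> (\<forall>y \<in> D. \<not> (x \<prec> y \<and> y \<prec> b)))"

definition interval :: "'a \<Rightarrow> 'a \<Rightarrow> 'a set" where
  "interval a b = {x \<in> universe M. a \<prec> x \<and> x \<prec> b}"

text \<open>The Cantor-Bendixson derivative for the topology generated by half-open intervals that
  contain their left end point.\<close>

definition right_deriv :: "'a set \<Rightarrow> 'a set" where
  "right_deriv X = {x \<in> X. \<forall>b \<in> universe M. x \<prec> b \<longrightarrow> (\<exists>y \<in> X. x \<prec> y \<and> y \<prec> b)}"

lemma irrefl: "x \<in> universe M \<Longrightarrow> \<not> x \<prec> x"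
  using DLO by (auto simp: DLO_def irreflp_on_def)

lemma less_trans:
  "x \<prec> y \<Longrightarrow> y \<prec> z \<Longrightarrow> x \<in> universe M \<Longrightarrow> y \<in> universe M \<Longrightarrow> z \<in> universe M \<Longrightarrow> x \<prec> z"
  using DLO unfolding DLO_def by (blast dest: transp_onD)

lemma total: "x \<in> universe M \<Longrightarrow> y \<in> universe M \<Longrightarrow> x \<noteq> y \<Longrightarrow> x \<prec> y \<or> y \<prec> x"
  using DLO unfolding DLO_def by (blast dest: totalp_onD)

lemma dense: "x \<in> universe M \<Longrightarrow> y \<in> universe M \<Longrightarrow> x \<prec> y \<Longrightarrow> \<exists>z \<in> universe M. x \<prec> z \<and> z \<prec> y"
  using DLO unfolding DLO_def by blast

lemma no_greatest: "x \<in> universe M \<Longrightarrow> \<exists>y \<in> universe M. x \<prec> y"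
  using DLO unfolding DLO_def by blast

lemma no_least: "x \<in> universe M \<Longrightarrow> \<exists>y \<in> universe M. y \<prec> x"
  using DLO unfolding DLO_def by blast

lemma less_asym: "x \<prec> y \<Longrightarrow> x \<in> universe M \<Longrightarrow> y \<in> universe M \<Longrightarrow> \<not> y \<prec> x"
  using less_trans irrefl by blast

lemma min_ex:
  assumes "b \<in> universe M" "c \<in> universe M"
  obtains m where "m \<in> {b, c}" "\<And>y. y \<in> universe M \<Longrightarrow> y \<prec> m \<Longrightarrow> y \<prec> b \<and> y \<prec> c"
  using assms total less_trans by (metis insert_iff)

lemma max_ex:
  assumes "b \<in> universe M" "c \<in> universe M"
  obtains m where "m \<in> {b, c}" "\<And>y. y \<in> universe M \<Longrightarrow> m \<prec> y \<Longrightarrow> b \<prec> y \<and> c \<prec> y"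
  using assms total less_trans by (metis insert_iff)

section \<open>Order topology, discrete sets and derivatives\<close>

lemma open_contains_interval:
  assumes "openin (order_topology_in lt M) W" "x \<in> W"
  shows "x \<in> universe M \<and>
    (\<exists>a \<in> universe M. \<exists>b \<in> universe M. a \<prec> x \<and> x \<prec> b \<and> interval a b \<subseteq> W)"
proof -
  have "generate_topology_on
      ((\<lambda>a. {x \<in> universe M. a \<prec> x}) ` universe M \<union> (\<lambda>a. {x \<in> universe M. x \<prec> a}) ` universe M) W"
    using assms(1) by (simp add: order_topology_in_def openin_topology_generated_by_iff)
  then show ?thesis using assms(2)
  proof (induction arbitrary: x)
    case Empty
    then show ?case by simp
  next
    \<comment> \<open>The larger left end point and the smaller right end point bound an interval
      inside both sets.\<close>
    case (Int A B)
    from Int.IH(1)[of x] Int.prems obtain a b where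
      1: "x \<in> universe M" "a \<in> universe M" "b \<in> universe M" "a \<prec> x" "x \<prec> b" "interval a b \<subseteq> A"
      by auto
    from Int.IH(2)[of x] Int.prems obtain c d where
      2: "c \<in> universe M" "d \<in> universe M" "c \<prec> x" "x \<prec> d" "interval c d \<subseteq> B"
      by auto
    obtain m where m: "m \<in> {b, d}" "\<And>y. y \<in> universe M \<Longrightarrow> y \<prec> m \<Longrightarrow> y \<prec> b \<and> y \<prec> d"
      using min_ex 1(3) 2(2) by blast
    obtain n where n: "n \<in> {a, c}" "\<And>y. y \<in> universe M \<Longrightarrow> n \<prec> y \<Longrightarrow> a \<prec> y \<and> c \<prec> y"
      using max_ex 1(2) 2(1) by blast
    have "interval n m \<subseteq> A \<inter> B"
      using m(2) n(2) 1(6) 2(5) unfolding interval_def by blast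
    moreover have "n \<in> universe M" "m \<in> universe M" "n \<prec> x" "x \<prec> m"
      using m(1) n(1) 1 2 by auto
    ultimately show ?case using 1(1) by blast
  next
    case (UN K)
    then show ?case by (meson Union_upper UnionE subset_trans)
  next
    case (Basis s)
    \<comment> \<open>A ray gives only one end point; the other exists because the order has no
      extreme elements.\<close>
    then show ?case using no_greatest no_least by (force simp: interval_def)
  qed
qed

text \<open>An open set that meets \<open>D\<close> in \<open>x\<close> alone contains an interval
  around \<open>x\<close>, and the right end of that interval isolates \<open>x\<close>.\<close>

lemma discrete_imp_right_isolated:
  assumes "D \<subseteq> universe M" "subtopology (order_topology_in lt M) D = discrete_topology D"
  shows "right_isolated D"
  unfolding right_isolated_def
proof
  fix x assume x: "x \<in> D"
  then have "openin (subtopology (order_topology_in lt M) D) {x}"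
    using assms by simp
  then obtain T where T: "openin (order_topology_in lt M) T" "{x} = T \<inter> D"
    by (auto simp: openin_subtopology)
  then obtain a b where ab: "b \<in> universe M" "a \<in> universe M" "a \<prec> x" "x \<prec> b" "interval a b \<subseteq> T"
    using open_contains_interval[OF T(1), of x] by auto
  have "\<not> (x \<prec> y \<and> y \<prec> b)" if y: "y \<in> D" for y
  proof
    assume *: "x \<prec> y \<and> y \<prec> b"
    then have "y \<in> interval a b"
      using less_trans[of a x y] ab x y assms(1) by (auto simp: interval_def)
    then have "y = x" using ab T y by blast
    then show False using * irrefl x assms(1) by blast
  qed
  then show "\<exists>b \<in> universe M. x \<prec> b \<and> (\<forall>y \<in> D. \<not> (x \<prec> y \<and> y \<prec> b))"
    using ab by blast
qed

text \<open>The Cantor--Bendixson rank of a union of finitely many discrete sets is at most their number: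
  every right neighbourhood of a point of the \<open>k\<close>-th derivative meets more than \<open>k\<close> of them, because
  a small one meets the discrete set containing the point only in the point itself.\<close>

lemma right_deriv_rank:
  assumes "finite \<D>" "\<And>D. D \<in> \<D> \<Longrightarrow> right_isolated D" "X \<subseteq> \<Union>\<D>" "X \<subseteq> universe M"
    and "x \<in> (right_deriv ^^ k) X" "b \<in> universe M" "x \<prec> b"
  shows "k < card {D \<in> \<D>. \<exists>y \<in> D \<inter> X. (y = x \<or> x \<prec> y) \<and> y \<prec> b}"
  using assms(5-7)
proof (induction k arbitrary: x b)
  case 0
  then obtain D where "D \<in> \<D>" "x \<in> D \<inter> X" using assms(3) by auto
  then have "D \<in> {D \<in> \<D>. \<exists>y \<in> D \<inter> X. (y = x \<or> x \<prec> y) \<and> y \<prec> b}" using 0 by auto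
  then show ?case using assms(1) by (metis (no_types, lifting) card_gt_0_iff empty_iff finite_subset mem_Collect_eq subsetI)
next
  case (Suc k)
  let ?Y = "(right_deriv ^^ k) X"
  let ?S = "\<lambda>x b. {D \<in> \<D>. \<exists>y \<in> D \<inter> X. (y = x \<or> x \<prec> y) \<and> y \<prec> b}"
  have sub: "(right_deriv ^^ j) X \<subseteq> X" for j
    by (induction j) (auto simp: right_deriv_def)
  have x: "x \<in> X" "x \<in> right_deriv ?Y" using sub[of "Suc k"] Suc.prems by auto
  then obtain D where D: "D \<in> \<D>" "x \<in> D" using assms(3) by auto
  obtain c where c: "c \<in> universe M" "x \<prec> c" "\<And>y. y \<in> D \<Longrightarrow> \<not> (x \<prec> y \<and> y \<prec> c)"
    using assms(2)[OF D(1)] D(2) unfolding right_isolated_def by blast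
  obtain m where m: "m \<in> {b, c}" "\<And>y. y \<in> universe M \<Longrightarrow> y \<prec> m \<Longrightarrow> y \<prec> b \<and> y \<prec> c"
    using min_ex[OF Suc.prems(2) c(1)] by blast
  have mU: "m \<in> universe M" "x \<prec> m" using m(1) c Suc.prems by auto
  obtain y where y: "y \<in> ?Y" "x \<prec> y" "y \<prec> m"
    using x(2) mU unfolding right_deriv_def by blast
  have U: "x \<in> universe M" "y \<in> universe M" using x y sub[of k] assms(4) by auto
  have after: "x \<prec> z" if "z \<in> X" "z = y \<or> y \<prec> z" for z
    using that y less_trans[of x y z] U assms(4) by blast
  \<comment> \<open>The set \<open>D\<close> no longer counts: the witnesses for the left side lie
    strictly between \<open>x\<close> and \<open>c\<close>, where \<open>D\<close> has no
    points.\<close>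
  have "?S y m \<subseteq> ?S x b - {D}"
  proof
    fix E assume "E \<in> ?S y m"
    then obtain z where z: "E \<in> \<D>" "z \<in> E" "z \<in> X" "z = y \<or> y \<prec> z" "z \<prec> m" by blast
    moreover have "z \<prec> b" "z \<prec> c" using m(2)[of z] z assms(4) by auto
    ultimately show "E \<in> ?S x b - {D}" using after[of z] c(3) by blast
  qed
  moreover have "finite (?S x b)" using assms(1) by simp
  ultimately have "card (?S y m) \<le> card (?S x b - {D})"
    by (intro card_mono) auto
  moreover have "D \<in> ?S x b" using D x Suc.prems by blast
  then have "card (?S x b - {D}) < card (?S x b)"
    using \<open>finite (?S x b)\<close> by (rule card_Diff1_less[rotated])
  moreover have "k < card (?S y m)"
    using Suc.IH[OF y(1) mU(1) y(3)] .
  ultimately show ?case by linarith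
qed

text \<open>A point left over would force \<open>right_deriv_rank\<close> to count more than
  \<open>card \<D>\<close> members of \<open>\<D>\<close>.\<close>

lemma right_deriv_funpow_empty:
  assumes "finite \<D>" "\<And>D. D \<in> \<D> \<Longrightarrow> right_isolated D" "X \<subseteq> \<Union>\<D>" "X \<subseteq> universe M"
  shows "(right_deriv ^^ card \<D>) X = {}"
proof (rule ccontr)
  assume "(right_deriv ^^ card \<D>) X \<noteq> {}"
  then obtain x where x: "x \<in> (right_deriv ^^ card \<D>) X" by blast
  have "(right_deriv ^^ j) X \<subseteq> X" for j
    by (induction j) (auto simp: right_deriv_def)
  then obtain b where b: "b \<in> universe M" "x \<prec> b"
    using no_greatest x assms(4) by blast
  let ?S = "{D \<in> \<D>. \<exists>y \<in> D \<inter> X. (y = x \<or> x \<prec> y) \<and> y \<prec> b}"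
  have "card \<D> < card ?S"
    using right_deriv_rank[OF assms x b] .
  moreover have "card ?S \<le> card \<D>"
    using assms(1) by (intro card_mono) auto
  ultimately show False by simp
qed

section \<open>Sets containing an interval versus thin sets\<close>

lemma open_union_discrete_cases:
  assumes "open_union_finitely_many_discrete lt M X"
  obtains a b where "a \<in> universe M" "b \<in> universe M" "a \<prec> b" "interval a b \<subseteq> X"
  | \<D> where "finite \<D>" "X = \<Union>\<D>" "\<And>D. D \<in> \<D> \<Longrightarrow> right_isolated D"
proof -
  obtain W \<D> where W: "X = W \<union> \<Union>\<D>" "openin (order_topology_in lt M) W" "finite \<D>"
      "\<And>D. D \<in> \<D> \<Longrightarrow> D \<subseteq> universe M \<and> subtopology (order_topology_in lt M) D = discrete_topology D"
    using assms unfolding open_union_finitely_many_discrete_def by blast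
  show ?thesis
  proof (cases "W = {}")
    case True
    then show ?thesis using that(2)[of \<D>] W discrete_imp_right_isolated by auto
  next
    case False
    then obtain x where "x \<in> W" by blast
    from open_contains_interval[OF W(2) this] obtain a b where
      "x \<in> universe M" "a \<in> universe M" "b \<in> universe M" "a \<prec> x" "x \<prec> b" "interval a b \<subseteq> W"
      by blast
    then show ?thesis using that(1)[of a b] less_trans[of a x b] W(1) by blast
  qed
qed

text \<open>A convex set with two points contains the interval between them, and finitely many sets
  of at most one point have a finite union.\<close>

lemma convex_union_cases:
  assumes "finite \<C>" "\<And>C. C \<in> \<C> \<Longrightarrow> convex_in lt M C" "X = \<Union>\<C>"
  obtains a b where "a \<in> universe M" "b \<in> universe M" "a \<prec> b" "interval a b \<subseteq> X" | "finite X"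
proof (cases "\<exists>C \<in> \<C>. \<exists>a \<in> C. \<exists>b \<in> C. a \<prec> b")
  case True
  then obtain C a b where C: "C \<in> \<C>" "a \<in> C" "b \<in> C" "a \<prec> b" by blast
  then have "interval a b \<subseteq> C" "a \<in> universe M" "b \<in> universe M"
    using assms(2)[of C] unfolding convex_in_def interval_def by blast+
  then show ?thesis using that(1)[of a b] C assms(3) by blast
next
  case False
  have "finite C" if "C \<in> \<C>" for C
  proof -
    have "x = y" if "x \<in> C" "y \<in> C" for x y
      using that False \<open>C \<in> \<C>\<close> assms(2)[of C] total[of x y] unfolding convex_in_def by blast
    \<comment> \<open>This form also covers an empty \<open>C\<close>.\<close>
    then have "C \<subseteq> {SOME x. x \<in> C}" by (metis insertI1 someI subsetI)
    then show ?thesis by (rule finite_subset) simp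
  qed
  then show ?thesis using that(2) assms by blast
qed

end

section \<open>Dimension of thin definable sets\<close>

locale dim_dlo = dim_fun L M \<delta> + dlo M lt
  for L :: "('f, 'r) language" and M :: "('f, 'r, 'a) fo_structure"
    and \<delta> :: "'a list set \<Rightarrow> nat option" and lt :: 'r +
  assumes lt_arity: "rel_arity L lt = 2"
begin

lemma definable_less: "definable_pred L M (\<lambda>v. v i \<prec> v j)"
  by (rule definable_pred_rel2[OF universe_nonempty lt_arity])

lemma definable_above: "a \<in> universe M \<Longrightarrow> definable_subset L M {x \<in> universe M. a \<prec> x}"
  by (rule definable_section[of L M "\<lambda>a x. a \<prec> x"]) (rule definable_less)

lemma definable_below: "a \<in> universe M \<Longrightarrow> definable_subset L M {x \<in> universe M. x \<prec> a}"
  by (rule definable_section[of L M "\<lambda>a x. x \<prec> a"]) (rule definable_less)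

lemma definable_interval:
  assumes "a \<in> universe M" "b \<in> universe M"
  shows "definable_subset L M (interval a b)"
proof -
  let ?A = "{x \<in> universe M. a \<prec> x}" and ?B = "{x \<in> universe M. x \<prec> b}"
  have "definable_pred L M (\<lambda>v. v 0 \<in> ?A \<and> v 0 \<in> ?B)"
    by (rule definable_pred_conj[OF definable_pred_mem1[OF definable_above[OF assms(1)]]
          definable_pred_mem1[OF definable_below[OF assms(2)]]])
  from definable_subsetI[of L M "\<lambda>x. x \<in> ?A \<and> x \<in> ?B", OF this] show ?thesis
    by (rule back_subst[of "definable_subset L M"]) (auto simp: interval_def)
qed

lemma interval_nonempty:
  assumes "a \<in> universe M" "b \<in> universe M" "a \<prec> b"
  shows "interval a b \<noteq> {}"
  using dense[OF assms] unfolding interval_def by blast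

lemma definable_right_deriv:
  assumes X: "definable_subset L M X"
  shows "definable_subset L M (right_deriv X)"
proof -
  have "definable_pred L M (\<lambda>v. v 2 \<in> X \<and> v 0 \<prec> v 2 \<and> v 2 \<prec> v 1)"
    by (intro definable_pred_conj definable_less definable_pred_mem1[OF X])
  from definable_pred_ex[OF this, of 2]
  have "definable_pred L M (\<lambda>v. \<exists>y \<in> universe M. y \<in> X \<and> v 0 \<prec> y \<and> y \<prec> v 1)" by simp
  from definable_pred_all[OF definable_pred_imp[OF definable_less[of 0 1] this], of 1]
  have "definable_pred L M (\<lambda>v. \<forall>b \<in> universe M. v 0 \<prec> b \<longrightarrow>
      (\<exists>y \<in> universe M. y \<in> X \<and> v 0 \<prec> y \<and> y \<prec> b))" by simp
  from definable_subsetI[OF definable_pred_conj[OF definable_pred_mem1[OF X] this]]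
  have "definable_subset L M {x \<in> universe M. x \<in> X \<and> (\<forall>b \<in> universe M. x \<prec> b \<longrightarrow>
      (\<exists>y \<in> universe M. y \<in> X \<and> x \<prec> y \<and> y \<prec> b))}" .
  moreover have "{x \<in> universe M. x \<in> X \<and> (\<forall>b \<in> universe M. x \<prec> b \<longrightarrow>
      (\<exists>y \<in> universe M. y \<in> X \<and> x \<prec> y \<and> y \<prec> b))} = right_deriv X"
    using definable_subset_sub[OF X] unfolding right_deriv_def by blast
  ultimately show ?thesis by simp
qed

lemma dim1_right_isolated:
  assumes intervals: "\<And>a b. a \<in> universe M \<Longrightarrow> b \<in> universe M \<Longrightarrow> a \<prec> b \<Longrightarrow> dim1 (interval a b) = Some 1"
    and D: "definable_subset L M D" "right_isolated D"
  shows "dim1 D \<noteq> Some 1"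
proof
  assume dim: "dim1 D = Some 1"
  have sub: "D \<subseteq> universe M" by (rule definable_subset_sub[OF D(1)])
  \<comment> \<open>\<open>x\<close> is the last point of \<open>D\<close> before \<open>z\<close>,
    and \<open>z\<close> is outside \<open>D\<close>, since otherwise \<open>y = z\<close> would
    violate the condition. The next point of \<open>D\<close> after \<open>x\<close>, which need not
    exist, is never named.\<close>
  define R where "R x z \<longleftrightarrow> x \<in> D \<and> x \<prec> z \<and>
    \<not> (\<exists>y \<in> universe M. y \<in> D \<and> x \<prec> y \<and> \<not> z \<prec> y)" for x z
  have "definable_pred L M (\<lambda>v. v 2 \<in> D \<and> v 0 \<prec> v 2 \<and> \<not> v 1 \<prec> v 2)"
    by (intro definable_pred_conj definable_pred_neg definable_less definable_pred_mem1[OF D(1)])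
  from definable_pred_ex[OF this, of 2]
  have "definable_pred L M (\<lambda>v. \<exists>y \<in> universe M. y \<in> D \<and> v 0 \<prec> y \<and> \<not> v 1 \<prec> y)" by simp
  from definable_pred_conj[OF definable_pred_mem1[OF D(1), of 0]
      definable_pred_conj[OF definable_less[of 0 1] definable_pred_neg[OF this]]]
  have R: "definable_pred L M (\<lambda>v. R (v 0) (v 1))" unfolding R_def .
  \<comment> \<open>Right isolation puts an interval starting at \<open>x\<close> into the fibre
    over \<open>x\<close>, which therefore has dimension 1.\<close>
  have fib: "\<exists>b \<in> universe M. x \<prec> b \<and> interval x b \<subseteq> {z \<in> universe M. R x z}" if x: "x \<in> D" for x
  proof -
    obtain b where b: "b \<in> universe M" "x \<prec> b" "\<And>y. y \<in> D \<Longrightarrow> \<not> (x \<prec> y \<and> y \<prec> b)"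
      using D(2) x unfolding right_isolated_def by blast
    have "R x z" if z: "z \<in> universe M" "x \<prec> z" "z \<prec> b" for z
    proof -
      have "z \<prec> y" if y: "y \<in> D" "x \<prec> y" for y
      proof -
        have "y \<in> universe M" using y sub by blast
        moreover have "\<not> y \<prec> b" using b(3) y by blast
        ultimately show ?thesis
          using z b(1) total[of z y] less_trans[of y z b] by blast
      qed
      then show ?thesis using x z by (auto simp: R_def)
    qed
    then show ?thesis using b(1,2) by (auto simp: interval_def)
  qed
  let ?B = "{z \<in> universe M. \<exists>x \<in> universe M. R x z}"
  have "map_option (\<lambda>d. d + 1) (dim1 D) = map_option (\<lambda>d. d + 0) (dim1 ?B)"
  proof (rule dim1_double_fibration[OF R])
    show "D = {x \<in> universe M. \<exists>y \<in> universe M. R x y}"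
    proof
      show "D \<subseteq> {x \<in> universe M. \<exists>y \<in> universe M. R x y}"
      proof
        fix x assume x: "x \<in> D"
        obtain b where b: "b \<in> universe M" "x \<prec> b" "interval x b \<subseteq> {z \<in> universe M. R x z}"
          using fib[OF x] by blast
        then show "x \<in> {x \<in> universe M. \<exists>y \<in> universe M. R x y}"
          using interval_nonempty[of x b] x sub by blast
      qed
    qed (auto simp: R_def)
    fix x assume x: "x \<in> D"
    then obtain b where b: "b \<in> universe M" "x \<prec> b" "interval x b \<subseteq> {z \<in> universe M. R x z}"
      using fib by blast
    have xU: "x \<in> universe M" using x sub by blast
    have def: "definable_subset L M {z \<in> universe M. R x z}"
      by (rule definable_section[OF R xU])
    have "Some 1 \<le> dim1 {z \<in> universe M. R x z}"
      using dim1_mono[OF definable_interval[OF xU b(1)] def b(3)] intervals[OF xU b(1,2)] by simp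
    have "{z \<in> universe M. R x z} \<noteq> {}"
      using interval_nonempty[OF xU b(1,2)] b(3) by blast
    from dim1_cases[OF def this] show "dim1 {z \<in> universe M. R x z} = Some 1"
      using \<open>Some 1 \<le> dim1 {z \<in> universe M. R x z}\<close> by cases simp_all
  next
    fix z assume "z \<in> ?B"
    then obtain x where x: "x \<in> universe M" "R x z" "z \<in> universe M" by blast
    \<comment> \<open>Of two candidates, the smaller is not the last one before
      \<open>z\<close>.\<close>
    have "x' = x" if x': "R x' z" "x' \<in> universe M" for x'
    proof (rule ccontr)
      assume "x' \<noteq> x"
      then have "x \<prec> x' \<or> x' \<prec> x" using total x x' by blast
      then show False using x x' less_asym unfolding R_def by blast
    qed
    then have "{x \<in> universe M. R x z} = {x}" using x by blast
    then show "dim1 {x \<in> universe M. R x z} = Some 0" using x by (simp add: dim1_singleton)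
  qed auto
  \<comment> \<open>The left side is 1 + 1, but no subset of the universe has dimension 2.\<close>
  then have B: "dim1 ?B = Some 2" using dim by (simp add: option.map_ident numeral_2_eq_2)
  have "definable_subset L M ?B"
    using definable_domain[of L M "\<lambda>z x. R x z", OF definable_pred_swap[OF R]] .
  moreover have "?B \<noteq> {}"
  proof
    assume "?B = {}"
    show False using B unfolding \<open>?B = {}\<close> dim1_empty by simp
  qed
  ultimately show False using B by (cases rule: dim1_cases) simp_all
qed

text \<open>The members of \<open>\<D>\<close> may fail to be definable, so they only bound the
  number of derivatives of \<open>X\<close>. The derivatives are definable, and so is each layer
  that one of them removes; \<open>dim1_right_isolated\<close> applies to these layers.\<close>

lemma dim1_finite_union_right_isolated:
  assumes intervals: "\<And>a b. a \<in> universe M \<Longrightarrow> b \<in> universe M \<Longrightarrow> a \<prec> b \<Longrightarrow> dim1 (interval a b) = Some 1"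
    and X: "definable_subset L M X" "X = \<Union>\<D>" "finite \<D>" "\<And>D. D \<in> \<D> \<Longrightarrow> right_isolated D"
  shows "dim1 X \<noteq> Some 1"
proof -
  have "dim1 Y \<noteq> Some 1" if "definable_subset L M Y" "(right_deriv ^^ k) Y = {}" for k Y
    using that
  proof (induction k arbitrary: Y)
    case 0
    then show ?case by (simp add: dim1_empty)
  next
    case (Suc k)
    let ?I = "{x \<in> universe M. x \<in> Y \<and> x \<notin> right_deriv Y}"
    have sub: "Y \<subseteq> universe M" by (rule definable_subset_sub[OF Suc.prems(1)])
    have I: "definable_subset L M ?I"
      by (intro definable_subsetI definable_pred_conj definable_pred_neg definable_pred_mem1
          definable_right_deriv Suc.prems)
    \<comment> \<open>A point of \<open>Y\<close> outside \<open>right_deriv Y\<close> has an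
      interval to its right without points of \<open>Y\<close>, hence without points of
      \<open>?I\<close>.\<close>
    have "right_isolated ?I"
      unfolding right_isolated_def right_deriv_def by blast
    then have "dim1 ?I \<noteq> Some 1"
      using dim1_right_isolated[OF intervals I] by blast
    moreover have "dim1 (right_deriv Y) \<noteq> Some 1"
      \<comment> \<open>With the innermost derivative split off, the first \<open>k\<close>
        derivatives exhaust \<open>right_deriv Y\<close>.\<close>
      using Suc by (simp add: definable_right_deriv funpow_Suc_right del: funpow.simps)
    moreover have "Y = ?I \<union> right_deriv Y" using sub by (auto simp: right_deriv_def)
    then have "dim1 Y = max (dim1 ?I) (dim1 (right_deriv Y))"
      using dim1_Un[OF I definable_right_deriv[OF Suc.prems(1)]] by simp
    ultimately show ?case by (simp add: max_def)
  qed
  then show ?thesis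
    using right_deriv_funpow_empty[OF X(3,4)] X(1,2) definable_subset_sub[OF X(1)] by blast
qed

end

section \<open>Dimension of intervals\<close>

text \<open>Only the ordered loop structure is needed: the additive law is never reassociated.\<close>

locale dim_ordered_loop = dim_dlo L M \<delta> lt
  for L :: "('f, 'r) language" and M :: "('f, 'r, 'a) fo_structure"
    and \<delta> :: "'a list set \<Rightarrow> nat option" and lt :: 'r +
  fixes addf :: 'f and zero :: 'a
  assumes add_arity: "fun_arity L addf = 2"
    and zero_closed: "zero \<in> universe M"
    and add_closed: "x \<in> universe M \<Longrightarrow> y \<in> universe M \<Longrightarrow> op_in M addf x y \<in> universe M"
    and zero_add: "x \<in> universe M \<Longrightarrow> op_in M addf zero x = x"
    and add_zero: "x \<in> universe M \<Longrightarrow> op_in M addf x zero = x"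
    and left_solve: "x \<in> universe M \<Longrightarrow> y \<in> universe M \<Longrightarrow> \<exists>w \<in> universe M. op_in M addf x w = y"
    and right_solve: "x \<in> universe M \<Longrightarrow> y \<in> universe M \<Longrightarrow> \<exists>w \<in> universe M. op_in M addf w x = y"
    and add_left_mono: "x \<in> universe M \<Longrightarrow> y \<in> universe M \<Longrightarrow> c \<in> universe M \<Longrightarrow>
      less_in M lt x y \<Longrightarrow> less_in M lt (op_in M addf c x) (op_in M addf c y)"
    and add_right_mono: "x \<in> universe M \<Longrightarrow> y \<in> universe M \<Longrightarrow> c \<in> universe M \<Longrightarrow>
      less_in M lt x y \<Longrightarrow> less_in M lt (op_in M addf x c) (op_in M addf y c)"
begin

abbreviation add (infixl \<open>\<oplus>\<close> 65) where "x \<oplus> y \<equiv> op_in M addf x y"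

section \<open>Cancellation and translation\<close>

lemma dim1_split:
  assumes "definable_subset L M A" "definable_subset L M B" "c \<in> universe M" "C = A \<union> {c} \<union> B"
  shows "dim1 C = max (max (dim1 A) (Some 0)) (dim1 B)"
proof -
  have "definable_subset L M (A \<union> {c})"
    by (rule definable_subset_Un[OF assms(1) definable_singleton[OF assms(3)]])
  then have "dim1 C = max (dim1 (A \<union> {c})) (dim1 B)"
    unfolding assms(4) by (rule dim1_Un[OF _ assms(2)])
  then show ?thesis
    unfolding dim1_Un[OF assms(1) definable_singleton[OF assms(3)]] dim1_singleton[OF assms(3)] .
qed

lemma add_less_cancel_left:
  assumes "x \<in> universe M" "y \<in> universe M" "c \<in> universe M"
  shows "c \<oplus> x \<prec> c \<oplus> y \<longleftrightarrow> x \<prec> y"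
proof
  assume *: "c \<oplus> x \<prec> c \<oplus> y"
  then have "x \<noteq> y" using irrefl add_closed assms by blast
  moreover have "\<not> y \<prec> x"
    using * less_asym[of "c \<oplus> x" "c \<oplus> y"] add_left_mono[of y x c] add_closed assms by blast
  ultimately show "x \<prec> y" using total assms by blast
qed (use add_left_mono assms in blast)

lemma add_less_cancel_right:
  assumes "x \<in> universe M" "y \<in> universe M" "c \<in> universe M"
  shows "x \<oplus> c \<prec> y \<oplus> c \<longleftrightarrow> x \<prec> y"
proof
  assume *: "x \<oplus> c \<prec> y \<oplus> c"
  then have "x \<noteq> y" using irrefl add_closed assms by blast
  moreover have "\<not> y \<prec> x"
    using * less_asym[of "x \<oplus> c" "y \<oplus> c"] add_right_mono[of y x c] add_closed assms by blast
  ultimately show "x \<prec> y" using total assms by blast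
qed (use add_right_mono assms in blast)

lemma add_left_cancel:
  assumes "x \<in> universe M" "y \<in> universe M" "c \<in> universe M" "c \<oplus> x = c \<oplus> y"
  shows "x = y"
proof (rule ccontr)
  assume "x \<noteq> y"
  then have "c \<oplus> x \<prec> c \<oplus> y \<or> c \<oplus> y \<prec> c \<oplus> x"
    using total add_left_mono assms(1-3) by blast
  then show False using irrefl[OF add_closed[OF assms(3,2)]] assms(4) by simp
qed

lemma add_right_cancel:
  assumes "x \<in> universe M" "y \<in> universe M" "c \<in> universe M" "x \<oplus> c = y \<oplus> c"
  shows "x = y"
proof (rule ccontr)
  assume "x \<noteq> y"
  then have "x \<oplus> c \<prec> y \<oplus> c \<or> y \<oplus> c \<prec> x \<oplus> c"
    using total add_right_mono assms(1-3) by blast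
  then show False using irrefl[OF add_closed[OF assms(2,3)]] assms(4) by simp
qed

text \<open>Adding \<open>c\<close> on the left is a definable order isomorphism, surjective by
  \<open>left_solve\<close>.\<close>

lemma dim1_translate:
  assumes c: "c \<in> universe M" and a: "a \<in> universe M"
  shows "dim1 (interval c (c \<oplus> a)) = dim1 (interval zero a)"
proof -
  have sub: "interval zero a \<subseteq> universe M" by (auto simp: interval_def)
  have "(\<lambda>x. c \<oplus> x) ` interval zero a = interval c (c \<oplus> a)"
  proof
    show "(\<lambda>x. c \<oplus> x) ` interval zero a \<subseteq> interval c (c \<oplus> a)"
    proof
      fix y assume "y \<in> (\<lambda>x. c \<oplus> x) ` interval zero a"
      then obtain x where x: "y = c \<oplus> x" "x \<in> universe M" "zero \<prec> x" "x \<prec> a"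
        unfolding interval_def by blast
      then show "y \<in> interval c (c \<oplus> a)"
        using add_left_mono[OF zero_closed x(2) c x(3)] add_left_mono[OF x(2) a c x(4)]
          add_closed c add_zero[OF c] by (simp add: interval_def)
    qed
    show "interval c (c \<oplus> a) \<subseteq> (\<lambda>x. c \<oplus> x) ` interval zero a"
    proof
      fix y assume y: "y \<in> interval c (c \<oplus> a)"
      then obtain x where x: "x \<in> universe M" "c \<oplus> x = y"
        using left_solve[OF c, of y] unfolding interval_def by blast
      have "c \<oplus> zero \<prec> c \<oplus> x" "c \<oplus> x \<prec> c \<oplus> a"
        using y x(2) add_zero[OF c] by (simp_all add: interval_def)
      then have "x \<in> interval zero a"
        using x(1) add_less_cancel_left[OF _ _ c] zero_closed a by (simp add: interval_def)
      then show "y \<in> (\<lambda>x. c \<oplus> x) ` interval zero a" using x(2) by blast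
    qed
  qed
  moreover have "dim1 ((\<lambda>x. c \<oplus> x) ` interval zero a) = dim1 (interval zero a)"
  proof (rule dim1_image)
    \<comment> \<open>The summand \<open>c\<close> enters as coordinate 2, which is then fixed as a
      parameter.\<close>
    have "definable_pred L M (\<lambda>v. v 2 \<oplus> v 0 = v 1)"
      by (rule definable_pred_fun2[OF universe_nonempty add_arity])
    from definable_pred_param[OF this c, of 2]
    have "definable_pred L M (\<lambda>v. v 1 = c \<oplus> v 0)" by (simp add: eq_commute)
    then show "definable_pred L M (\<lambda>v. v 0 \<in> interval zero a \<and> v 1 = c \<oplus> v 0)"
      by (rule definable_pred_conj[OF definable_pred_mem1[OF definable_interval[OF zero_closed a]]])
    show "(\<lambda>x. c \<oplus> x) ` interval zero a \<subseteq> universe M" using add_closed c sub by blast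
    show "inj_on (\<lambda>x. c \<oplus> x) (interval zero a)"
      using add_left_cancel[OF _ _ c] sub by (intro inj_onI) blast
  qed (rule sub)
  ultimately show ?thesis by simp
qed

text \<open>The relation \<open>x \<oplus> y = zero\<close> matches negative with positive elements:
  solvability on either side gives partners, and cancellation makes them unique. It stands in for
  negation, which has no symbol.\<close>

lemma dim1_negative:
  "dim1 {x \<in> universe M. x \<prec> zero} = dim1 {x \<in> universe M. zero \<prec> x}"
proof -
  have R: "definable_pred L M (\<lambda>v. v 0 \<in> {x \<in> universe M. x \<prec> zero} \<and> v 0 \<oplus> v 1 = zero)"
    using definable_pred_param[OF definable_pred_fun2[OF universe_nonempty add_arity, of 0 1 2] zero_closed, of 2]
    by (intro definable_pred_conj definable_pred_mem1 definable_below zero_closed) simp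
  have sign: "x \<prec> zero \<longleftrightarrow> zero \<prec> y" if "x \<in> universe M" "y \<in> universe M" "x \<oplus> y = zero" for x y
    using add_less_cancel_right[OF that(1) zero_closed that(2)] that zero_add[OF that(2)] by simp
  have "map_option (\<lambda>d. d + 0) (dim1 {x \<in> universe M. x \<prec> zero}) =
      map_option (\<lambda>d. d + 0) (dim1 {x \<in> universe M. zero \<prec> x})"
  proof (rule dim1_double_fibration[OF R])
    show "{x \<in> universe M. x \<prec> zero} =
        {x \<in> universe M. \<exists>y \<in> universe M. x \<in> {x \<in> universe M. x \<prec> zero} \<and> x \<oplus> y = zero}"
      using left_solve[OF _ zero_closed] by blast
    show "{x \<in> universe M. zero \<prec> x} =
        {y \<in> universe M. \<exists>x \<in> universe M. x \<in> {x \<in> universe M. x \<prec> zero} \<and> x \<oplus> y = zero}"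
      using right_solve[OF _ zero_closed] sign by blast
    fix x assume x: "x \<in> {x \<in> universe M. x \<prec> zero}"
    then obtain y where y: "y \<in> universe M" "x \<oplus> y = zero"
      using left_solve[OF _ zero_closed] by blast
    have "{y \<in> universe M. x \<in> {x \<in> universe M. x \<prec> zero} \<and> x \<oplus> y = zero} = {y}"
    proof (intro equalityI subsetI)
      fix w assume "w \<in> {y \<in> universe M. x \<in> {x \<in> universe M. x \<prec> zero} \<and> x \<oplus> y = zero}"
      then show "w \<in> {y}" using x y add_left_cancel[of w y x] by simp
    qed (use x y in simp)
    then show "dim1 {y \<in> universe M. x \<in> {x \<in> universe M. x \<prec> zero} \<and> x \<oplus> y = zero} = Some 0"
      using dim1_singleton[OF y(1)] by simp
  next
    fix y assume y: "y \<in> {x \<in> universe M. zero \<prec> x}"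
    then obtain x where x: "x \<in> universe M" "x \<oplus> y = zero"
      using right_solve[OF _ zero_closed] by blast
    have "{x \<in> universe M. x \<in> {x \<in> universe M. x \<prec> zero} \<and> x \<oplus> y = zero} = {x}"
    proof (intro equalityI subsetI)
      fix w assume "w \<in> {x \<in> universe M. x \<in> {x \<in> universe M. x \<prec> zero} \<and> x \<oplus> y = zero}"
      then show "w \<in> {x}" using x y add_right_cancel[of w x y] by simp
    qed (use x y sign[of x y] in simp)
    then show "dim1 {x \<in> universe M. x \<in> {x \<in> universe M. x \<prec> zero} \<and> x \<oplus> y = zero} = Some 0"
      using dim1_singleton[OF x(1)] by simp
  qed simp_all
  then show ?thesis by (simp add: option.map_ident)
qed

text \<open>The two half-lines have equal dimension and, together with zero, fill the universe, of
  dimension 1.\<close>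

lemma dim1_positive: "dim1 {x \<in> universe M. zero \<prec> x} = Some 1"
proof -
  let ?P = "{x \<in> universe M. zero \<prec> x}" and ?N = "{x \<in> universe M. x \<prec> zero}"
  have "universe M = (?N \<union> {zero}) \<union> ?P" using total[OF zero_closed] zero_closed by blast
  from dim1_split[OF definable_below[OF zero_closed] definable_above[OF zero_closed] zero_closed this]
  have *: "Some 1 = max (max (dim1 ?P) (Some 0)) (dim1 ?P)"
    by (simp add: dim1_universe dim1_negative)
  have "?P \<noteq> {}" using no_greatest[OF zero_closed] by blast
  from dim1_cases[OF definable_above[OF zero_closed] this] show ?thesis
    using * by cases simp_all
qed

text \<open>The common starting point: definable completeness or homotheties spread this property
  from one \<open>a\<close> to all.\<close>

lemma ex_interval_dim1:
  obtains a where "a \<in> universe M" "zero \<prec> a" "dim1 (interval zero a) \<noteq> Some 0"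
proof (rule ccontr)
  assume "\<not> thesis"
  then have null: "dim1 (interval zero a) = Some 0" if "a \<in> universe M" "zero \<prec> a" for a
    using that \<open>\<And>a. a \<in> universe M \<Longrightarrow> zero \<prec> a \<Longrightarrow> dim1 (interval zero a) \<noteq> Some 0 \<Longrightarrow> thesis\<close>
    by blast
  let ?P = "{x \<in> universe M. zero \<prec> x}"
  have R: "definable_pred L M (\<lambda>v. v 1 \<in> ?P \<and> v 1 \<prec> v 0)"
    by (rule definable_pred_conj[OF definable_pred_mem1[OF definable_above[OF zero_closed]] definable_less])
  have "map_option (\<lambda>d. d + 0) (dim1 ?P) = map_option (\<lambda>d. d + 1) (dim1 ?P)"
  proof (rule dim1_double_fibration[OF R])
    show "?P = {x \<in> universe M. \<exists>y \<in> universe M. y \<in> ?P \<and> y \<prec> x}"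
      using dense[OF zero_closed] less_trans[OF _ _ zero_closed] by blast
    show "?P = {y \<in> universe M. \<exists>x \<in> universe M. y \<in> ?P \<and> y \<prec> x}"
      using no_greatest by blast
    fix x assume "x \<in> ?P"
    moreover have "{y \<in> universe M. y \<in> ?P \<and> y \<prec> x} = interval zero x"
      by (auto simp: interval_def)
    ultimately show "dim1 {y \<in> universe M. y \<in> ?P \<and> y \<prec> x} = Some 0" using null by simp
  next
    fix b assume b: "b \<in> ?P"
    let ?Q = "{x \<in> universe M. b \<prec> x}"
    have bU: "b \<in> universe M" "zero \<prec> b" using b by auto
    \<comment> \<open>Removing \<open>interval zero b\<close> and the point \<open>b\<close>, both
      of dimension 0, leaves the ray above \<open>b\<close> with the full dimension of
      \<open>?P\<close>.\<close>
    have "?P = interval zero b \<union> {b} \<union> ?Q"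
      using b total[of b] less_trans[of zero b] zero_closed unfolding interval_def by blast
    from dim1_split[OF definable_interval[OF zero_closed bU(1)] definable_above[OF bU(1)] bU(1) this]
    have *: "Some 1 = max (Some 0) (dim1 ?Q)" by (simp add: null[OF bU] dim1_positive)
    have ne: "?Q \<noteq> {}" using no_greatest[OF bU(1)] by blast
    have "dim1 ?Q = Some 1"
      using dim1_cases[OF definable_above[OF bU(1)] ne] by cases (use * in simp_all)
    moreover have "{x \<in> universe M. b \<in> ?P \<and> b \<prec> x} = ?Q" using bU by blast
    ultimately show "dim1 {x \<in> universe M. b \<in> ?P \<and> b \<prec> x} = Some 1" by simp
  qed simp_all
  then show False by (simp add: dim1_positive)
qed

text \<open>Every interval is a translate of one that starts at zero.\<close>

lemma dim1_interval_from_zero: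
  assumes pos: "\<And>a. a \<in> universe M \<Longrightarrow> zero \<prec> a \<Longrightarrow> dim1 (interval zero a) \<noteq> Some 0"
    and ab: "a \<in> universe M" "b \<in> universe M" "a \<prec> b"
  shows "dim1 (interval a b) = Some 1"
proof -
  obtain d where d: "d \<in> universe M" "a \<oplus> d = b" using left_solve ab by blast
  have "zero \<prec> d"
    using add_less_cancel_left[OF zero_closed d(1) ab(1)] add_zero[OF ab(1)] d ab by simp
  then have "interval zero d \<noteq> {}" "dim1 (interval zero d) \<noteq> Some 0"
    using interval_nonempty zero_closed d(1) pos by blast+
  then have "dim1 (interval zero d) = Some 1"
    using dim1_cases[OF definable_interval[OF zero_closed d(1)]] by metis
  then show ?thesis using dim1_translate[OF ab(1) d(1)] d(2) by simp
qed

text \<open>A supremum \<open>u\<close> of \<open>?H\<close> in the universe is impossible, because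
  adding \<open>h\<close> carries an element of \<open>?H\<close> close to \<open>u\<close> beyond
  \<open>u\<close> while staying in \<open>?H\<close>. If the supremum were infinite,
  \<open>?H\<close> would be cofinal, against \<open>ex_interval_dim1\<close>.\<close>

lemma dim1_interval_definably_complete:
  assumes "definably_complete L lt M" "a \<in> universe M" "b \<in> universe M" "a \<prec> b"
  shows "dim1 (interval a b) = Some 1"
proof (rule dim1_interval_from_zero[OF _ assms(2-4)])
  fix h assume hU: "h \<in> universe M" and hpos: "zero \<prec> h"
  show "dim1 (interval zero h) \<noteq> Some 0"
  proof
    assume h0: "dim1 (interval zero h) = Some 0"
    let ?H = "{a \<in> universe M. zero \<prec> a \<and> dim1 (interval zero a) = Some 0}"
    have hH: "h \<in> ?H" using hU hpos h0 by simp
    have R: "definable_pred L M (\<lambda>v. v 1 \<in> {x \<in> universe M. zero \<prec> x} \<and> v 1 \<prec> v 0)"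
      by (rule definable_pred_conj[OF definable_pred_mem1[OF definable_above[OF zero_closed]] definable_less])
    \<comment> \<open>\<open>?H\<close> consists of the \<open>x\<close> whose fibre under this
      relation has dimension 0, so it is definable by the axiom on fibres.\<close>
    have "definable_subset L M {x \<in> universe M.
        (\<exists>y \<in> universe M. y \<in> {x \<in> universe M. zero \<prec> x} \<and> y \<prec> x) \<and>
        dim1 {y \<in> universe M. y \<in> {x \<in> universe M. zero \<prec> x} \<and> y \<prec> x} = Some 0}"
      by (rule definable_fibre_dim[OF R]) simp
    moreover have "{x \<in> universe M.
        (\<exists>y \<in> universe M. y \<in> {x \<in> universe M. zero \<prec> x} \<and> y \<prec> x) \<and>
        dim1 {y \<in> universe M. y \<in> {x \<in> universe M. zero \<prec> x} \<and> y \<prec> x} = Some 0} = ?H"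
    proof (intro Collect_cong conj_cong refl)
      fix x assume x: "x \<in> universe M"
      show "(\<exists>y \<in> universe M. y \<in> {x \<in> universe M. zero \<prec> x} \<and> y \<prec> x) \<longleftrightarrow> zero \<prec> x"
        using dense[OF zero_closed x] less_trans[OF _ _ zero_closed _ x] by blast
      have "{y \<in> universe M. y \<in> {x \<in> universe M. zero \<prec> x} \<and> y \<prec> x} = interval zero x"
        unfolding interval_def by blast
      then show "(dim1 {y \<in> universe M. y \<in> {x \<in> universe M. zero \<prec> x} \<and> y \<prec> x} = Some 0) \<longleftrightarrow>
          dim1 (interval zero x) = Some 0" by simp
    qed
    ultimately have "definable_subset L M ?H" by simp
    then obtain s where s: "is_sup (universe M) (less_in M lt) ?H s"
      using assms(1) unfolding definably_complete_def by blast
    have ub: "ext_le (less_in M lt) (Fin x) s" if "x \<in> ?H" for x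
      using s that unfolding is_sup_def by blast
    have lub: "ext_le (less_in M lt) s (Fin t)"
      if "t \<in> universe M" "\<And>x. x \<in> ?H \<Longrightarrow> x \<prec> t \<or> x = t" for t
    proof -
      have "\<forall>x \<in> ?H. ext_le (less_in M lt) (Fin x) (Fin t)"
        using that(2) unfolding ext_le.simps by blast
      then show ?thesis using s that(1) unfolding is_sup_def by blast
    qed
    have above: "\<exists>x \<in> ?H. t \<prec> x" if "t \<in> universe M" "\<not> ext_le (less_in M lt) s (Fin t)" for t
    proof (rule ccontr)
      assume "\<not> (\<exists>x \<in> ?H. t \<prec> x)"
      then have "x \<prec> t \<or> x = t" if "x \<in> ?H" for x
        using that total[of x t] \<open>t \<in> universe M\<close> by blast
      then show False using lub[OF that(1)] that(2) by blast
    qed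
    show False
    proof (cases s)
      case (Fin u)
      then have u: "u \<in> universe M" using s by (auto simp: is_sup_def)
      \<comment> \<open>\<open>t\<close> lies below \<open>u\<close> by the amount \<open>h\<close>,
        so it is not an upper bound of \<open>?H\<close>.\<close>
      obtain t where t: "t \<in> universe M" "t \<oplus> h = u" using right_solve[OF hU u] by blast
      have "t \<prec> u"
        using add_left_mono[OF zero_closed hU t(1) hpos] add_zero[OF t(1)] t(2) by simp
      then have "\<not> ext_le (less_in M lt) s (Fin t)"
        using less_asym[OF _ t(1) u] irrefl[OF u] Fin by auto
      from above[OF t(1) this] obtain g where g: "g \<in> ?H" "t \<prec> g" by blast
      have gU: "g \<in> universe M" "zero \<prec> g" "dim1 (interval zero g) = Some 0" using g(1) by auto
      let ?k = "g \<oplus> h"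
      have k: "?k \<in> universe M" by (rule add_closed[OF gU(1) hU])
      have gk: "g \<prec> ?k" using add_left_mono[OF zero_closed hU gU(1) hpos] add_zero[OF gU(1)] by simp
      have "u \<prec> ?k" using add_right_mono[OF t(1) gU(1) hU g(2)] t(2) by simp
      \<comment> \<open>The second interval is a translate of \<open>interval zero h\<close>, so all
        pieces have dimension 0 and \<open>?k\<close> is in \<open>?H\<close>.\<close>
      have "interval zero ?k = interval zero g \<union> {g} \<union> interval g ?k"
        using total[OF gU(1)] less_trans[of zero g] less_trans[of _ g ?k] gU gk k zero_closed
        unfolding interval_def by blast
      from dim1_split[OF definable_interval[OF zero_closed gU(1)] definable_interval[OF gU(1) k] gU(1) this]
      have "dim1 (interval zero ?k) = Some 0"
        using gU(3) h0 dim1_translate[OF gU(1) hU] by simp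
      then have "?k \<in> ?H"
        using k less_trans[OF gU(2) gk zero_closed gU(1) k] by simp
      from ub[OF this] have "?k \<prec> u \<or> ?k = u" unfolding Fin by simp
      then show False using \<open>u \<prec> ?k\<close> less_asym[OF _ u k] irrefl[OF u] by auto
    next
      case Pinf
      obtain a where a: "a \<in> universe M" "zero \<prec> a" "dim1 (interval zero a) \<noteq> Some 0"
        by (rule ex_interval_dim1)
      have "\<not> ext_le (less_in M lt) s (Fin a)" by (simp add: Pinf)
      \<comment> \<open>A member of \<open>?H\<close> beyond \<open>a\<close> forces dimension 0 on
        \<open>interval zero a\<close> by monotonicity.\<close>
      from above[OF a(1) this] obtain g where g: "g \<in> ?H" "a \<prec> g" by blast
      then have "interval zero a \<subseteq> interval zero g"
        using less_trans[of _ a g] a(1) unfolding interval_def by blast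
      moreover have "definable_subset L M (interval zero g)" "dim1 (interval zero g) = Some 0"
        using definable_interval[OF zero_closed] g by auto
      ultimately have *: "dim1 (interval zero a) \<le> Some 0"
        using dim1_mono[OF definable_interval[OF zero_closed a(1)]] by metis
      from dim1_cases[OF definable_interval[OF zero_closed a(1)]
          interval_nonempty[OF zero_closed a(1,2)]]
      show False using * a(3) by cases simp_all
    next
      case Minf
      then show False using ub[OF hH] by simp
    qed
  qed
qed

end

section \<open>Homotheties\<close>

context dim_ordered_loop
begin

text \<open>Multiplication by \<open>a\<close> is a definable order isomorphism from
  \<open>interval zero u\<close> onto \<open>interval zero a\<close>. The laws of multiplication are
  listed as hypotheses because the locale carries addition only.\<close>

lemma dim1_scale:
  assumes mul_arity: "fun_arity L mulf = 2"
    and a: "a \<in> universe M" and u: "u \<in> universe M"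
    and closed: "\<And>x. x \<in> universe M \<Longrightarrow> op_in M mulf a x \<in> universe M"
    and mul_zero: "op_in M mulf a zero = zero" and mul_u: "op_in M mulf a u = a"
    and distrib: "\<And>x y. x \<in> universe M \<Longrightarrow> y \<in> universe M \<Longrightarrow>
      op_in M mulf a (x \<oplus> y) = op_in M mulf a x \<oplus> op_in M mulf a y"
    and pos: "\<And>x. x \<in> universe M \<Longrightarrow> zero \<prec> x \<Longrightarrow> zero \<prec> op_in M mulf a x"
    and solve: "\<And>y. y \<in> universe M \<Longrightarrow> \<exists>x \<in> universe M. op_in M mulf a x = y"
  shows "dim1 (interval zero a) = dim1 (interval zero u)"
proof -
  let ?f = "\<lambda>x. op_in M mulf a x"
  \<comment> \<open>Write \<open>y\<close> as \<open>x \<oplus> d\<close> with \<open>d\<close>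
    positive, and use distributivity and positivity of the product with \<open>d\<close>.\<close>
  have mono: "?f x \<prec> ?f y" if xy: "x \<in> universe M" "y \<in> universe M" "x \<prec> y" for x y
  proof -
    obtain d where d: "d \<in> universe M" "x \<oplus> d = y" using left_solve xy by blast
    have "zero \<prec> d"
      using add_less_cancel_left[OF zero_closed d(1) xy(1)] add_zero[OF xy(1)] d xy by simp
    from add_left_mono[OF zero_closed closed[OF d(1)] closed[OF xy(1)] pos[OF d(1) this]]
    show ?thesis using distrib[OF xy(1) d(1)] add_zero[OF closed[OF xy(1)]] d(2) by simp
  qed
  have iff: "?f x \<prec> ?f y \<longleftrightarrow> x \<prec> y" if xy: "x \<in> universe M" "y \<in> universe M" for x y
  proof
    assume *: "?f x \<prec> ?f y"
    then have "x \<noteq> y" using irrefl[OF closed[OF xy(1)]] by blast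
    moreover have "\<not> y \<prec> x"
      using * mono[OF xy(2,1)] less_asym[OF _ closed[OF xy(1)] closed[OF xy(2)]] by blast
    ultimately show "x \<prec> y" using total[OF xy] by blast
  qed (rule mono[OF xy])
  have sub: "interval zero u \<subseteq> universe M" by (auto simp: interval_def)
  have "?f ` interval zero u = interval zero a"
  proof
    show "?f ` interval zero u \<subseteq> interval zero a"
    proof
      fix y assume "y \<in> ?f ` interval zero u"
      then obtain x where x: "y = ?f x" "x \<in> universe M" "zero \<prec> x" "x \<prec> u"
        unfolding interval_def by blast
      show "y \<in> interval zero a"
        using pos[OF x(2,3)] mono[OF x(2) u x(4)] closed[OF x(2)]
        unfolding interval_def x(1) mul_u by simp
    qed
    show "interval zero a \<subseteq> ?f ` interval zero u"
    proof
      fix y assume y: "y \<in> interval zero a"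
      then obtain x where x: "x \<in> universe M" "?f x = y"
        using solve unfolding interval_def by blast
      have "?f zero \<prec> ?f x" "?f x \<prec> ?f u"
        using y unfolding interval_def x(2) mul_u mul_zero by simp_all
      then have "x \<in> interval zero u"
        unfolding iff[OF zero_closed x(1)] iff[OF x(1) u] using x(1) by (simp add: interval_def)
      then show "y \<in> ?f ` interval zero u" using x(2) by blast
    qed
  qed
  moreover have "dim1 (?f ` interval zero u) = dim1 (interval zero u)"
  proof (rule dim1_image)
    have "definable_pred L M (\<lambda>v. op_in M mulf (v 2) (v 0) = v 1)"
      by (rule definable_pred_fun2[OF universe_nonempty mul_arity])
    from definable_pred_param[OF this a, of 2]
    have "definable_pred L M (\<lambda>v. v 1 = ?f (v 0))" by (simp add: eq_commute)
    then show "definable_pred L M (\<lambda>v. v 0 \<in> interval zero u \<and> v 1 = ?f (v 0))"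
      by (rule definable_pred_conj[OF definable_pred_mem1[OF definable_interval[OF zero_closed u]]])
    show "?f ` interval zero u \<subseteq> universe M" using closed sub by blast
    show "inj_on ?f (interval zero u)"
    proof (rule inj_onI)
      fix x y assume "x \<in> interval zero u" "y \<in> interval zero u" and eq: "?f x = ?f y"
      then have xy: "x \<in> universe M" "y \<in> universe M" using sub by blast+
      show "x = y"
        using iff[OF xy] iff[OF xy(2,1)] irrefl[OF closed[OF xy(2)]] total[OF xy] unfolding eq by blast
    qed
  qed (rule sub)
  ultimately show ?thesis by simp
qed

text \<open>By \<open>ex_interval_dim1\<close> some interval at zero does not have dimension 0, and
  by \<open>u\<close> all of them share its dimension.\<close>

lemma dim1_interval_homogeneous:
  assumes u: "\<And>a. a \<in> universe M \<Longrightarrow> zero \<prec> a \<Longrightarrow> dim1 (interval zero a) = dim1 (interval zero u)"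
    and ab: "a \<in> universe M" "b \<in> universe M" "a \<prec> b"
  shows "dim1 (interval a b) = Some 1"
proof (rule dim1_interval_from_zero[OF _ ab])
  obtain c where c: "c \<in> universe M" "zero \<prec> c" "dim1 (interval zero c) \<noteq> Some 0"
    by (rule ex_interval_dim1)
  fix d assume "d \<in> universe M" "zero \<prec> d"
  then show "dim1 (interval zero d) \<noteq> Some 0" using u[OF c(1,2)] u[of d] c(3) by simp
qed

end

text \<open>The right-hand side mentions the order and not \<open>\<delta>\<close>, so dimension
  functions agree on \<open>X\<close>. The hypotheses \<open>intervals\<close> and
  \<open>thin\<close> collect what the two kinds of structure supply in different ways.\<close>

lemma (in dim_dlo) dim1_eq:
  assumes intervals: "\<And>a b. a \<in> universe M \<Longrightarrow> b \<in> universe M \<Longrightarrow> a \<prec> b \<Longrightarrow> dim1 (interval a b) = Some 1"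
    and X: "definable_subset L M X"
    and thin: "\<not> (\<exists>a \<in> universe M. \<exists>b \<in> universe M. a \<prec> b \<and> interval a b \<subseteq> X) \<Longrightarrow> dim1 X \<noteq> Some 1"
  shows "dim1 X = (if X = {} then None
    else if \<exists>a \<in> universe M. \<exists>b \<in> universe M. a \<prec> b \<and> interval a b \<subseteq> X then Some 1 else Some 0)"
proof (cases "X = {}")
  case True
  then show ?thesis by (simp add: dim1_empty)
next
  case False
  show ?thesis
  proof (cases "\<exists>a \<in> universe M. \<exists>b \<in> universe M. a \<prec> b \<and> interval a b \<subseteq> X")
    case True
    then obtain a b where ab: "a \<in> universe M" "b \<in> universe M" "a \<prec> b" "interval a b \<subseteq> X" by blast
    have "Some 1 \<le> dim1 X"
      using dim1_mono[OF definable_interval[OF ab(1,2)] X ab(4)] intervals[OF ab(1-3)] by simp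
    with dim1_cases[OF X False] have "dim1 X = Some 1" by cases simp_all
    then show ?thesis using True False by simp
  next
    case no_interval: False
    with dim1_cases[OF X False] have "dim1 X = Some 0" using thin by cases simp_all
    then show ?thesis using False no_interval by simp
  qed
qed

section \<open>Isomorphic copies\<close>

definition image_structure ::
    "('a \<Rightarrow> 'b) \<Rightarrow> ('f, 'r, 'a) fo_structure \<Rightarrow> ('f, 'r, 'b) fo_structure" where
  "image_structure h M = \<lparr>universe = h ` universe M,
     fun_of = \<lambda>f xs. h (fun_of M f (map (inv_into UNIV h) xs)),
     rel_of = \<lambda>r xs. rel_of M r (map (inv_into UNIV h) xs)\<rparr>"

lemma image_structure_simps [simp]:
  "universe (image_structure h M) = h ` universe M"
  "fun_of (image_structure h M) f xs = h (fun_of M f (map (inv_into UNIV h) xs))"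
  by (simp_all add: image_structure_def)

lemma rel_of_image_structure:
  "rel_of (image_structure h M) r xs = rel_of M r (map (inv_into UNIV h) xs)"
  by (simp add: image_structure_def)

lemma less_in_image_structure:
  "inj h \<Longrightarrow> less_in (image_structure h M) lt (h a) (h b) = less_in M lt a b"
  by (simp add: rel_of_image_structure)

lemma eval_image_structure:
  assumes "inj h"
  shows "eval_trm (image_structure h M) (h \<circ> e) t = h (eval_trm M e t)"
proof (induction t)
  case (Fn f ts)
  have "map (inv_into UNIV h) (map (eval_trm (image_structure h M) (h \<circ> e)) ts) = map (eval_trm M e) ts"
    using assms by (simp add: Fn[unfolded comp_def] comp_def)
  then show ?case by (simp only: eval_trm.simps image_structure_simps)
qed simp

lemma sat_image_structure:
  assumes "inj h"
  shows "sat (image_structure h M) (h \<circ> e) \<phi> = sat M e \<phi>"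
proof (induction \<phi> arbitrary: e)
  case (FEq s t)
  then show ?case
    by (simp only: sat.simps eval_image_structure[OF assms] inj_eq[OF assms])
next
  case (FRel r ts)
  have "map (inv_into UNIV h) (map (eval_trm (image_structure h M) (h \<circ> e)) ts) = map (eval_trm M e) ts"
    using assms by (simp add: eval_image_structure[OF assms])
  then show ?case by (simp only: sat.simps rel_of_image_structure)
next
  case (FEx i \<phi>)
  show ?case
    by (simp only: sat.simps image_structure_simps(1) bex_simps fun_upd_comp[symmetric] FEx)
qed simp_all

lemma is_structure_image_structure:
  assumes "inj h" "is_structure L M"
  shows "is_structure L (image_structure h M)"
  unfolding is_structure_def
proof (intro conjI allI ballI)
  show "universe (image_structure h M) \<noteq> {}" using assms(2) by (simp add: is_structure_def)
  fix f xs assume "xs \<in> tuples (universe (image_structure h M)) (fun_arity L f)"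
  then have "map (inv_into UNIV h) xs \<in> tuples (universe M) (fun_arity L f)"
    using assms(1) by (auto simp: tuples_def)
  then have "fun_of M f (map (inv_into UNIV h) xs) \<in> universe M" using assms(2) by (simp add: is_structure_def)
  then show "fun_of (image_structure h M) f xs \<in> universe (image_structure h M)"
    by simp
qed

lemma elementarily_equivalent_image_structure:
  fixes M :: "('f, 'r, 'a) fo_structure"
  assumes "inj h"
  shows "elementarily_equivalent L M (image_structure h M)"
proof -
  have "models M \<phi> \<longleftrightarrow> models (image_structure h M) \<phi>" for \<phi> :: "('f, 'r) fm"
  proof
    assume M: "models M \<phi>"
    show "models (image_structure h M) \<phi>"
      unfolding models_def
    proof (intro allI impI)
      fix e :: "nat \<Rightarrow> _" assume e: "range e \<subseteq> universe (image_structure h M)"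
      have "(inv_into UNIV h \<circ> e) i \<in> universe M" for i
      proof -
        have "e i \<in> h ` universe M" using e by auto
        then show ?thesis using assms by auto
      qed
      then have "range (inv_into UNIV h \<circ> e) \<subseteq> universe M" by blast
      \<comment> \<open>A valuation in the copy takes values in the range of \<open>h\<close>, so it
        is the image of a valuation in \<open>M\<close>.\<close>
      moreover have "h \<circ> (inv_into UNIV h \<circ> e) = e"
      proof
        fix i
        have "e i \<in> range h" using e by auto
        then show "(h \<circ> (inv_into UNIV h \<circ> e)) i = e i" by (simp add: f_inv_into_f)
      qed
      ultimately show "sat (image_structure h M) e \<phi>"
        using M sat_image_structure[OF assms, of M "inv_into UNIV h \<circ> e" \<phi>] by (simp add: models_def)
    qed
  next
    assume N: "models (image_structure h M) \<phi>"
    show "models M \<phi>"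
      unfolding models_def
    proof (intro allI impI)
      fix e :: "nat \<Rightarrow> _" assume "range e \<subseteq> universe M"
      then have "range (h \<circ> e) \<subseteq> universe (image_structure h M)" by auto
      then show "sat M e \<phi>" using N sat_image_structure[OF assms, of M e \<phi>] by (simp add: models_def)
    qed
  qed
  then show ?thesis by (simp add: elementarily_equivalent_def)
qed

text \<open>The same formula defines the image, with its parameters moved by
  \<open>h\<close>.\<close>

lemma definable_subset_image_structure:
  assumes "inj h" "definable_subset L M A"
  shows "definable_subset L (image_structure h M) (h ` A)"
proof -
  obtain \<phi> e where 1: "wf_fm L \<phi>" "range e \<subseteq> universe M"
    "(\<lambda>a. [a]) ` A = {xs \<in> tuples (universe M) 1. sat M (\<lambda>i. if i < 1 then xs ! i else e i) \<phi>}"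
    using assms(2) unfolding definable_subset_def Def_n_def by blast
  have mem: "a \<in> A \<longleftrightarrow> a \<in> universe M \<and> sat M (\<lambda>i. if i < 1 then a else e i) \<phi>" for a
  proof -
    have "a \<in> A \<longleftrightarrow> [a] \<in> (\<lambda>a. [a]) ` A" by blast
    also have "\<dots> \<longleftrightarrow> a \<in> universe M \<and> sat M (\<lambda>i. if i < 1 then [a] ! i else e i) \<phi>"
      unfolding 1(3) by (simp add: tuples_def)
    also have "(\<lambda>i. if i < 1 then [a] ! i else e i) = (\<lambda>i. if i < 1 then a else e i)" by auto
    finally show ?thesis .
  qed
  have "(\<lambda>i. if i < 1 then [h a] ! i else (h \<circ> e) i) = h \<circ> (\<lambda>i. if i < 1 then a else e i)" for a
    by auto
  then have "sat (image_structure h M) (\<lambda>i. if i < 1 then [h a] ! i else (h \<circ> e) i) \<phi> =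
      sat M (\<lambda>i. if i < 1 then a else e i) \<phi>" for a
    using sat_image_structure[OF assms(1)] by metis
  then have "(\<lambda>a. [a]) ` (h ` A) = {xs \<in> tuples (universe (image_structure h M)) 1.
      sat (image_structure h M) (\<lambda>i. if i < 1 then xs ! i else (h \<circ> e) i) \<phi>}"
    by (force simp: tuples_def length_Suc_conv mem simp del: comp_apply)
  moreover have "range (h \<circ> e) \<subseteq> universe (image_structure h M)" using 1(2) by auto
  ultimately show ?thesis
    unfolding definable_subset_def Def_n_def using 1(1) by blast
qed

lemma (in dlo) dlo_image_structure:
  assumes "inj h"
  shows "dlo (image_structure h M) lt"
proof
  show "DLO (universe (image_structure h M)) (less_in (image_structure h M) lt)"
    unfolding DLO_def image_structure_simps(1)
  proof (intro conjI)
    show "irreflp_on (h ` universe M) (less_in (image_structure h M) lt)"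
      using irrefl
      by (auto simp: irreflp_on_def less_in_image_structure[OF assms])
    show "transp_on (h ` universe M) (less_in (image_structure h M) lt)"
      using less_trans by (intro transp_onI) (auto simp: less_in_image_structure[OF assms])
    show "totalp_on (h ` universe M) (less_in (image_structure h M) lt)"
    proof (intro totalp_onI)
      fix x y assume "x \<in> h ` universe M" "y \<in> h ` universe M" "x \<noteq> y"
      then obtain a b where "a \<in> universe M" "b \<in> universe M" "a \<noteq> b" "x = h a" "y = h b" by blast
      then show "less_in (image_structure h M) lt x y \<or> less_in (image_structure h M) lt y x"
        using total[of a b] by (simp add: less_in_image_structure[OF assms])
    qed
  qed (use dense no_greatest no_least in \<open>simp_all add: less_in_image_structure[OF assms]\<close>)
qed

text \<open>The structures ranged over in \<^const>\<open>d_minimal\<close> live on another type, so the condition on \<open>M\<close>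
  itself is read off its copy consisting of constant functions.\<close>

lemma (in dlo) d_minimal_cases:
  assumes "d_minimal L lt M" "definable_subset L M X"
  obtains a b where "a \<in> universe M" "b \<in> universe M" "a \<prec> b" "interval a b \<subseteq> X"
  | \<D> where "finite \<D>" "X = \<Union>\<D>" "\<And>D. D \<in> \<D> \<Longrightarrow> right_isolated D"
proof -
  define h :: "'a \<Rightarrow> nat \<Rightarrow> 'a" where "h a = (\<lambda>_. a)" for a
  have h: "inj h" by (rule injI) (metis h_def)
  let ?N = "image_structure h M"
  interpret N: dlo ?N lt by (rule dlo_image_structure[OF h])
  have sub: "X \<subseteq> universe M" by (rule definable_subset_sub[OF assms(2)])
  have "is_structure L ?N"
    using assms(1) is_structure_image_structure[OF h] by (auto simp: d_minimal_def expansion_of_DLO_def)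
  then have "open_union_finitely_many_discrete lt ?N (h ` X)"
    using assms(1) elementarily_equivalent_image_structure[OF h]
      definable_subset_image_structure[OF h assms(2)]
    unfolding d_minimal_def by blast
  then show ?thesis
  proof (cases rule: N.open_union_discrete_cases)
    case (1 a' b')
    then obtain a b where ab: "a \<in> universe M" "b \<in> universe M" "a' = h a" "b' = h b" by auto
    have "interval a b \<subseteq> X"
    proof
      fix x assume "x \<in> interval a b"
      then have "h x \<in> N.interval a' b'" by (simp add: ab less_in_image_structure[OF h] interval_def N.interval_def)
      then show "x \<in> X" using 1(4) h by (auto dest: injD)
    qed
    then show ?thesis using that(1)[OF ab(1,2)] 1(3) by (simp add: ab less_in_image_structure[OF h])
  next
    case (2 \<D>)
    \<comment> \<open>Only right isolation is pulled back, so the two order topologies need not be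
      compared.\<close>
    have "right_isolated (h -` D)" if D: "D \<in> \<D>" for D
      unfolding right_isolated_def
    proof
      fix x assume "x \<in> h -` D"
      then have "h x \<in> D" by simp
      then obtain b' where b': "b' \<in> h ` universe M" "less_in ?N lt (h x) b'"
          "\<And>y. y \<in> D \<Longrightarrow> \<not> (less_in ?N lt (h x) y \<and> less_in ?N lt y b')"
        using 2(3)[OF D] unfolding N.right_isolated_def image_structure_simps(1) by blast
      then obtain b where b: "b' = h b" "b \<in> universe M" by blast
      have "\<not> (x \<prec> y \<and> y \<prec> b)" if "y \<in> h -` D" for y
        using b'(3)[of "h y"] that by (simp add: b(1) less_in_image_structure[OF h])
      moreover have "x \<prec> b" using b'(2) by (simp add: b(1) less_in_image_structure[OF h])
      ultimately show "\<exists>b \<in> universe M. x \<prec> b \<and> (\<forall>y \<in> h -` D. \<not> (x \<prec> y \<and> y \<prec> b))"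
        using b(2) by blast
    qed
    moreover have "X = \<Union>((\<lambda>D. h -` D) ` \<D>)"
    proof -
      have "X = h -` (h ` X)" using h by (simp add: inj_vimage_image_eq)
      then show ?thesis unfolding 2(2) by blast
    qed
    ultimately show ?thesis using that(2)[of "(\<lambda>D. h -` D) ` \<D>"] 2(1) by blast
  qed
qed

section \<open>Uniqueness\<close>

lemma (in dim_dlo) dim_ordered_loopI:
  assumes arity: "fun_arity L addf = 2"
    and group: "group \<lparr>carrier = universe M, monoid.mult = op_in M addf, one = z\<rparr>"
    and left: "\<And>a b c. a \<in> universe M \<Longrightarrow> b \<in> universe M \<Longrightarrow> c \<in> universe M \<Longrightarrow> a \<prec> b \<Longrightarrow>
      op_in M addf c a \<prec> op_in M addf c b"
    and right: "\<And>a b c. a \<in> universe M \<Longrightarrow> b \<in> universe M \<Longrightarrow> c \<in> universe M \<Longrightarrow> a \<prec> b \<Longrightarrow>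
      op_in M addf a c \<prec> op_in M addf b c"
  shows "dim_ordered_loop L M \<delta> lt addf z"
proof -
  interpret G: group "\<lparr>carrier = universe M, monoid.mult = op_in M addf, one = z\<rparr>"
    by (rule group)
  show ?thesis
  proof
    show "fun_arity L addf = 2" by (rule arity)
    show "z \<in> universe M" using G.one_closed by simp
    show "op_in M addf x y \<in> universe M" if "x \<in> universe M" "y \<in> universe M" for x y
      using G.m_closed[of x y] that by simp
    show "op_in M addf z x = x" "op_in M addf x z = x" if "x \<in> universe M" for x
      using G.l_one[of x] G.r_one[of x] that by simp_all
    show "\<exists>w \<in> universe M. op_in M addf x w = y" if "x \<in> universe M" "y \<in> universe M" for x y
      using that G.inv_solve_left' G.m_closed[OF G.inv_closed, of x y]
        G.m_assoc[of x "m_inv \<lparr>carrier = universe M, monoid.mult = op_in M addf, one = z\<rparr> x" y]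
        G.r_inv[of x] G.l_one[of y] G.inv_closed[of x] by (simp, metis)
    show "\<exists>w \<in> universe M. op_in M addf w x = y" if "x \<in> universe M" "y \<in> universe M" for x y
      using that G.m_closed[OF _ G.inv_closed, of y x]
        G.m_assoc[of y "m_inv \<lparr>carrier = universe M, monoid.mult = op_in M addf, one = z\<rparr> x" x]
        G.l_inv[of x] G.r_one[of y] G.inv_closed[of x] by (simp, metis)
  qed (use left right in blast)+
qed

lemma (in dim_dlo) dim1_interval_ordered_group:
  assumes "expansion_of_ordered_group L lt addf M" "definably_complete L lt M"
    and "a \<in> universe M" "b \<in> universe M" "a \<prec> b"
  shows "dim1 (interval a b) = Some 1"
proof -
  obtain z where z: "group \<lparr>carrier = universe M, monoid.mult = op_in M addf, one = z\<rparr>"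
    using assms(1) unfolding expansion_of_ordered_group_def by blast
  interpret dim_ordered_loop L M \<delta> lt addf z
    using assms(1) unfolding expansion_of_ordered_group_def
    by (intro dim_ordered_loopI z) blast+
  show ?thesis by (rule dim1_interval_definably_complete[OF assms(2-5)])
qed

text \<open>For \<open>c\<close> above zero, multiplication by \<open>c\<close> takes
  \<open>interval z u\<close> onto \<open>interval z c\<close>, so all intervals at zero have the
  same dimension.\<close>

lemma (in dim_dlo) dim1_interval_ordered_field:
  assumes F: "expansion_of_ordered_field L lt addf mulf M"
    and ab: "a \<in> universe M" "b \<in> universe M" "a \<prec> b"
  shows "dim1 (interval a b) = Some 1"
proof -
  obtain z u where field: "field \<lparr>carrier = universe M, monoid.mult = op_in M mulf, one = u,
      zero = z, ring.add = op_in M addf\<rparr>"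
    and mono: "\<And>a b c. a \<in> universe M \<Longrightarrow> b \<in> universe M \<Longrightarrow> c \<in> universe M \<Longrightarrow> a \<prec> b \<Longrightarrow>
      op_in M addf a c \<prec> op_in M addf b c"
    and pos: "\<And>a b. a \<in> universe M \<Longrightarrow> b \<in> universe M \<Longrightarrow> z \<prec> a \<Longrightarrow> z \<prec> b \<Longrightarrow> z \<prec> op_in M mulf a b"
    using F unfolding expansion_of_ordered_field_def by blast
  define R where "R = \<lparr>carrier = universe M, monoid.mult = op_in M mulf, one = u,
      zero = z, ring.add = op_in M addf\<rparr>"
  have R: "carrier R = universe M" "monoid.mult R = op_in M mulf" "one R = u" "zero R = z"
      "ring.add R = op_in M addf"
    by (simp_all add: R_def)
  interpret R: field R using field unfolding R_def .
  have "group \<lparr>carrier = universe M, monoid.mult = op_in M addf, one = z\<rparr>"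
    using R.add.is_group by (simp add: R_def)
  \<comment> \<open>Monotonicity is given for adding on the right; commutativity of addition yields
    the other side.\<close>
  moreover have "op_in M addf c a \<prec> op_in M addf c b"
    if "a \<in> universe M" "b \<in> universe M" "c \<in> universe M" "a \<prec> b" for a b c
    using mono[OF that] R.a_comm[unfolded R] that by metis
  ultimately interpret dim_ordered_loop L M \<delta> lt addf z
    using F mono unfolding expansion_of_ordered_field_def
    by (intro dim_ordered_loopI) blast+
  have arity: "fun_arity L mulf = 2" using F by (simp add: expansion_of_ordered_field_def)
  show ?thesis
  proof (rule dim1_interval_homogeneous[OF _ ab])
    fix c assume c: "c \<in> universe M" "z \<prec> c"
    have "c \<noteq> z" using c irrefl by blast
    \<comment> \<open>Invertibility of \<open>c\<close> supplies the surjectivity that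
      \<open>dim1_scale\<close> requires.\<close>
    then have unit: "c \<in> Units R" using c R.field_Units by (simp add: R)
    show "dim1 (interval z c) = dim1 (interval z u)"
    proof (rule dim1_scale[OF arity c(1)])
      show "u \<in> universe M" using R.one_closed by (simp add: R)
      show "op_in M mulf c x \<in> universe M" if "x \<in> universe M" for x
        using R.m_closed[of c x] c that by (simp add: R)
      show "op_in M mulf c z = z" using R.r_null[of c] c by (simp add: R)
      show "op_in M mulf c u = c" using R.r_one[of c] c by (simp add: R)
      show "op_in M mulf c (x \<oplus> y) = op_in M mulf c x \<oplus> op_in M mulf c y"
        if "x \<in> universe M" "y \<in> universe M" for x y
        using R.r_distr[of x y c] c that by (simp add: R)
      show "z \<prec> op_in M mulf c x" if "x \<in> universe M" "z \<prec> x" for x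
        using pos c that by blast
      show "\<exists>x \<in> universe M. op_in M mulf c x = y" if y: "y \<in> universe M" for y
      proof -
        have inv: "m_inv R c \<in> universe M" using R.Units_inv_closed[OF unit] by (simp add: R)
        have "op_in M mulf c (op_in M mulf (m_inv R c) y) = y"
          using R.m_assoc[of c "m_inv R c" y] R.Units_r_inv[OF unit] R.l_one[of y] c inv y
          by (simp add: R)
        moreover have "op_in M mulf (m_inv R c) y \<in> universe M"
          using R.m_closed[of "m_inv R c" y] inv y by (simp add: R)
        ultimately show ?thesis by blast
      qed
    qed
  qed
qed

theorem theorem3p10:
  fixes L :: "('f, 'r) language"
    and M :: "('f, 'r, 'a) fo_structure"
    and lt :: 'r and addf mulf :: 'f
  assumes "(d_minimal L lt M \<and> expansion_of_ordered_group L lt addf M) \<or>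
           (weakly_o_minimal L lt M \<and> expansion_of_ordered_field L lt addf mulf M)"
  shows "n_dim L M \<le>o cone"
proof -
  have expansion: "expansion_of_DLO L lt M"
    using assms by (auto simp: d_minimal_def weakly_o_minimal_def)
  then have ne: "universe M \<noteq> {}"
    by (simp add: expansion_of_DLO_def is_structure_def)
  interpret dlo M lt using expansion by unfold_locales (simp add: expansion_of_DLO_def)
  have dim_value: "\<delta> ((\<lambda>a. [a]) ` X) = (if X = {} then None
      else if \<exists>a \<in> universe M. \<exists>b \<in> universe M. a \<prec> b \<and> interval a b \<subseteq> X then Some 1 else Some 0)"
    if \<delta>: "dimension_function L M \<delta>" and X: "definable_subset L M X" for \<delta> X
  proof -
    interpret dim_dlo L M \<delta> lt
      using \<delta> ne expansion by unfold_locales (simp_all add: expansion_of_DLO_def)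
    have intervals: "dim1 (interval a b) = Some 1"
      if "a \<in> universe M" "b \<in> universe M" "a \<prec> b" for a b
      using assms
    proof
      assume *: "d_minimal L lt M \<and> expansion_of_ordered_group L lt addf M"
      then have "definably_complete L lt M" by (simp add: d_minimal_def)
      with * that show ?thesis using dim1_interval_ordered_group by blast
    next
      assume "weakly_o_minimal L lt M \<and> expansion_of_ordered_field L lt addf mulf M"
      with that show ?thesis using dim1_interval_ordered_field by blast
    qed
    have thin: "dim1 X \<noteq> Some 1"
      if no: "\<not> (\<exists>a \<in> universe M. \<exists>b \<in> universe M. a \<prec> b \<and> interval a b \<subseteq> X)"
      using assms
    proof
      assume "d_minimal L lt M \<and> expansion_of_ordered_group L lt addf M"
      then have "d_minimal L lt M" by blast
      from this X show ?thesis
      proof (cases rule: d_minimal_cases)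
        case (2 \<D>)
        then show ?thesis using dim1_finite_union_right_isolated[OF intervals X, of \<D>] by blast
      qed (use no in blast)
    next
      assume "weakly_o_minimal L lt M \<and> expansion_of_ordered_field L lt addf mulf M"
      then obtain \<C> where \<C>: "finite \<C>" "\<And>C. C \<in> \<C> \<Longrightarrow> convex_in lt M C" "X = \<Union>\<C>"
        using X unfolding weakly_o_minimal_def by blast
      have "finite X"
      proof (rule convex_union_cases[OF \<C>])
        show "finite X" if "a \<in> universe M" "b \<in> universe M" "a \<prec> b" "interval a b \<subseteq> X" for a b
          using no that by blast
      qed
      \<comment> \<open>A finite set has dimension 0, or \<open>None\<close> if it is empty.\<close>
      then show ?thesis
        using dim1_finite[OF _ definable_subset_sub[OF X]] dim1_empty by (cases "X = {}") auto
    qed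
    show ?thesis
      unfolding dim1_def[symmetric] by (rule dim1_eq) (fact intervals X thin)+
  qed
  have "\<delta> = \<delta>'" if "dimension_function L M \<delta>" "dimension_function L M \<delta>'" for \<delta> \<delta>'
    by (rule dimension_function_eqI[OF that ne])
      (simp only: dim_value[OF that(1)] dim_value[OF that(2)])
  \<comment> \<open>A set with at most one element injects into the singleton whose cardinal is
    \<open>cone\<close>.\<close>
  then have "inj_on (\<lambda>_. ()) {\<delta>. dimension_function L M \<delta>}"
    by (intro inj_onI) blast
  then show ?thesis
    unfolding n_dim_def cone_def by (intro iffD1[OF card_of_ordLeq] exI conjI) auto
qed

end
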